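(* Let $q\ge 2$ and $1\le\lambda<\infty$, and consider on $\mathcal P({\mathbb R})$ the interaction energy $E(\rho)=\frac12\iint V(x-y)\,d\rho(x)\,d\rho(y)$ with $V(x)=\frac{|x|^p}{p}-\frac{|x|^q}{q}$, $p>q$. There exists $p^*=p^*(q)$ such that if $p>p^*$, then $\rho^*=\frac12(\delta_0+\delta_1)$ is, up to translation, the unique $d_\lambda$-local minimizer of $E$. In particular, $\rho^*$ is the unique global minimizer of $E$ up to translation.
   Context: $\mathcal P({\mathbb R})$ is the set of Borel probability measures on ${\mathbb R}$, and $\mathcal P_\lambda({\mathbb R})$ those with finite moment of order $\lambda$. The $\lambda$-Wasserstein distance is $d_\lambda(\mu,\nu)=\big[\inf_{\pi\in\Pi(\mu,\nu)}\iint|x-y|^\lambda\,d\pi(x,y)\big]^{1/\lambda}$, where $\Pi(\mu,\nu)$ is the set of couplings of $\mu$ and $\nu$. A measure $\rho\in\mathcal P_\lambda({\mathbb R})$ is a $d_\lambda$-local minimizer of $E$ if there is $\eta>0$ such that $E(\rho)\le E(\rho')$ for every $\rho'\in\mathcal P_\lambda({\mathbb R})$ with $d_\lambda(\rho,\rho')\le\eta$. *)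

theory Defs
  imports "HOL-Probability.Probability"
begin

definition prob_R :: "real measure \<Rightarrow> bool" where
  "prob_R \<mu> \<longleftrightarrow> prob_space \<mu> \<and> sets \<mu> = sets borel"

definition prob_R_moment :: "real \<Rightarrow> real measure \<Rightarrow> bool" where
  "prob_R_moment lam \<mu> \<longleftrightarrow> prob_R \<mu> \<and> (\<integral>\<^sup>+ x. ennreal (\<bar>x\<bar> powr lam) \<partial>\<mu>) < \<infinity>"

definition couplings :: "real measure \<Rightarrow> real measure \<Rightarrow> (real \<times> real) measure set" where
  "couplings \<mu> \<nu> = {\<pi>. prob_space \<pi> \<and> sets \<pi> = sets (borel \<Otimes>\<^sub>M borel)
      \<and> distr \<pi> borel fst = \<mu> \<and> distr \<pi> borel snd = \<nu>}"

text \<open>lambda-Wasserstein distance (finite for measures in P_lambda).\<close>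
definition wasserstein :: "real \<Rightarrow> real measure \<Rightarrow> real measure \<Rightarrow> real" where
  "wasserstein lam \<mu> \<nu> =
     (enn2real (INF \<pi>\<in>couplings \<mu> \<nu>. \<integral>\<^sup>+ z. ennreal (\<bar>fst z - snd z\<bar> powr lam) \<partial>\<pi>)) powr (1 / lam)"

definition Vpot :: "real \<Rightarrow> real \<Rightarrow> real \<Rightarrow> real" where
  "Vpot p q x = \<bar>x\<bar> powr p / p - \<bar>x\<bar> powr q / q"

text \<open>Interaction energy E(rho) = 1/2 \<integral>\<integral> V(x-y) d rho d rho, as an extended real
  (positive part minus negative part; the negative part is finite since V is bounded below).\<close>
definition energy :: "real \<Rightarrow> real \<Rightarrow> real measure \<Rightarrow> ereal" where
  "energy p q \<rho> = ereal (1/2) *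
     (enn2ereal (\<integral>\<^sup>+ z. ennreal (max 0 (Vpot p q (fst z - snd z))) \<partial>(\<rho> \<Otimes>\<^sub>M \<rho>))
      - enn2ereal (\<integral>\<^sup>+ z. ennreal (max 0 (- Vpot p q (fst z - snd z))) \<partial>(\<rho> \<Otimes>\<^sub>M \<rho>)))"

definition local_minimizer :: "real \<Rightarrow> real \<Rightarrow> real \<Rightarrow> real measure \<Rightarrow> bool" where
  "local_minimizer p q lam \<rho> \<longleftrightarrow> prob_R_moment lam \<rho> \<and>
     (\<exists>\<eta>>0. \<forall>\<rho>'. prob_R_moment lam \<rho>' \<and> wasserstein lam \<rho> \<rho>' \<le> \<eta> \<longrightarrow> energy p q \<rho> \<le> energy p q \<rho>')"

definition rho_star :: "real \<Rightarrow> real measure" where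
  "rho_star c = measure_of UNIV (sets borel)
     (\<lambda>A. ennreal ((indicator A c + indicator A (c + 1)) / 2))"

end

theory Submission
  imports Defs "HOL-Real_Asymp.Real_Asymp"
begin

text \<open>
  Mixing a minimizer \<open>\<mu>\<close> with a little of any compactly supported measure is a small perturbation in
  the Wasserstein distance, so the potential \<open>V * \<mu>\<close> is globally minimal at the points of the
  support. Growth of \<open>V\<close> makes the support compact, and the second variation gives
  \<open>V (x - y) \<le> 0\<close> on it, so its diameter is at most \<open>1 + \<delta>\<close> once \<open>p\<close> is large. Since \<open>V'' < 0\<close> on
  \<open>0 < |u| < 1 - \<delta>\<close>, every point of the support has another one at distance at least \<open>1 - \<delta>\<close>, and
  the support splits into two short clusters near its end points. The Euler-Lagrange equations at the
  end points bound the mass of each cluster below. At a critical point of the potential within one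
  cluster, the first-order condition fixes the \<open>(p - 1)\<close>-moment of the distances to the other
  cluster, which forces the second derivative, of order \<open>p\<close>, to be positive. Between two
  support points of a cluster the potential would have an interior maximum, so each cluster is a
  single point, and stationarity gives distance 1 and equal masses.

  That the two-point measures are minimizers follows from the existence of a global minimizer: tightness
  up to translation, Helly's selection theorem, Skorohod's representation and Fatou's lemma.
\<close>

section \<open>The interaction potential\<close>

text \<open>As p grows, both the positive zero of V, (p/q)^(1/(p-q)), and its inflection point,
  ((q-1)/(p-1))^(1/(p-q)), tend to 1; this is why the diameter of the support and the separation of
  the clusters are both pinned to within \<delta> of 1. The obstacle is that \<delta> is fixed
  before p: for distances t up to 1 + \<delta> the powers t^p have no bound uniform in p, so V and
  V'' cannot be estimated directly across the clusters. Only powers with exponent at most q are then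
  compared with 1. A local minimizer comes with a finite moment of order lam only, so its energy
  might be infinite and its support unbounded. The variations are therefore run with the nonnegative
  kernel W = V + 1/q in \<open>ennreal\<close>; real-valued potentials appear only once the support
  is known to be bounded.\<close>

definition spow :: "real \<Rightarrow> real \<Rightarrow> real" where
  "spow s u = sgn u * \<bar>u\<bar> powr s"

text \<open>Isabelle's convention 0 powr 0 = 0 is overridden here: for q = 2 the second derivative of the
  potential at 0 is -1, not 0.\<close>
definition apow :: "real \<Rightarrow> real \<Rightarrow> real" where
  "apow s u = (if s = 0 then 1 else \<bar>u\<bar> powr s)"

lemma tendsto_abs_powr_0:
  fixes s :: real
  assumes "s > 0"
  shows "((\<lambda>h. \<bar>h\<bar> powr s) \<longlongrightarrow> 0) (at 0)"
  using assms by real_asymp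

text \<open>Away from 0 the sign of u is locally constant and the rule for powers applies; at 0 the
  difference quotient is \<open>spow (s - 1) h / s\<close>, which tends to 0 because s > 1.\<close>

lemma DERIV_abs_powr:
  assumes "s > 1"
  shows "((\<lambda>u. \<bar>u\<bar> powr s / s) has_real_derivative spow (s - 1) u) (at u)"
proof (cases "u = 0")
  case True
  have "((\<lambda>h. spow (s - 1) h / s) \<longlongrightarrow> 0) (at 0)"
    unfolding spow_def using assms by real_asymp
  moreover have "(\<bar>0 + h\<bar> powr s / s - \<bar>0\<bar> powr s / s) / h = spow (s - 1) h / s" if "h \<noteq> 0" for h
    using that by (auto simp: spow_def powr_diff sgn_if)
  ultimately show ?thesis
    unfolding True DERIV_def
    by (simp add: spow_def) (erule Lim_transform_eventually, auto simp: eventually_at_filter)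
next
  case False
  then consider "u > 0" | "u < 0" by linarith
  then show ?thesis
  proof cases
    case 1
    have "((\<lambda>u. u powr s / s) has_real_derivative spow (s - 1) u) (at u)"
      using 1 assms by (auto intro!: derivative_eq_intros simp: spow_def powr_diff)
    then show ?thesis
      by (rule has_field_derivative_transform_within_open[where S = "{0<..}"]) (use 1 in auto)
  next
    case 2
    have "((\<lambda>u. (-u) powr s / s) has_real_derivative spow (s - 1) u) (at u)"
      using 2 assms by (auto intro!: derivative_eq_intros simp: spow_def powr_diff)
    then show ?thesis
      by (rule has_field_derivative_transform_within_open[where S = "{..<0}"]) (use 2 in auto)
  qed
qed

lemma DERIV_spow:
  assumes "s \<ge> 1"
  shows "(spow s has_real_derivative s * apow (s - 1) u) (at u)"
proof (cases "u = 0")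
  case True
  have quot: "(spow s (0 + h) - spow s 0) / h = \<bar>h\<bar> powr (s - 1)" if "h \<noteq> 0" for h
    using that by (auto simp: spow_def powr_diff sgn_if)
  have "((\<lambda>h. \<bar>h\<bar> powr (s - 1)) \<longlongrightarrow> s * apow (s - 1) 0) (at 0)"
  \<comment> \<open>For s = 1 the quotient |h| powr 0 is 1 for every h \<noteq> 0, so the limit is
    1; \<open>apow\<close> is made to agree with it at 0.\<close>
  proof (cases "s = 1")
    case True
    have "eventually (\<lambda>h::real. \<bar>h\<bar> powr (s - 1) = s * apow (s - 1) 0) (at 0)"
      using True by (auto simp: eventually_at_filter apow_def)
    then show ?thesis by (rule tendsto_eventually)
  next
    case False
    then show ?thesis using assms tendsto_abs_powr_0[of "s - 1"] by (simp add: apow_def)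
  qed
  then show ?thesis
    unfolding True DERIV_def
    by (rule Lim_transform_eventually) (use quot in \<open>auto simp: eventually_at_filter\<close>)
next
  case False
  then consider "u > 0" | "u < 0" by linarith
  then show ?thesis
  proof cases
    case 1
    have "((\<lambda>u. u powr s) has_real_derivative s * apow (s - 1) u) (at u)"
      using has_real_derivative_powr[OF 1] by (rule DERIV_cong) (use 1 in \<open>simp add: apow_def\<close>)
    then show ?thesis
      by (rule has_field_derivative_transform_within_open[where S = "{0<..}"])
        (use 1 in \<open>auto simp: spow_def\<close>)
  next
    case 2
    have "((\<lambda>u. - ((-u) powr s)) has_real_derivative s * apow (s - 1) u) (at u)"
      by (rule DERIV_cong[OF DERIV_minus[OF DERIV_chain2[OF has_real_derivative_powr
              DERIV_minus[OF DERIV_ident]]]]) (use 2 in \<open>auto simp: apow_def\<close>)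
    then show ?thesis
      by (rule has_field_derivative_transform_within_open[where S = "{..<0}"])
        (use 2 in \<open>auto simp: spow_def\<close>)
  qed
qed

lemma continuous_on_apow [continuous_intros]:
  assumes "s \<ge> 0" "continuous_on A f"
  shows "continuous_on A (\<lambda>x. apow s (f x))"
  unfolding apow_def using assms
  by (cases "s = 0") (auto intro!: continuous_intros continuous_on_powr')

text \<open>Differentiation under the integral sign, by dominated convergence along sequences. The
  bounded support keeps all arguments in one compact interval, where the continuous
  \<open>f'\<close> is bounded and the mean value inequality supplies a constant majorant.\<close>

lemma DERIV_convolution:
  fixes f f' :: "real \<Rightarrow> real"
  assumes "prob_space M" and sets_M [measurable_cong]: "sets M = sets borel"
    and bdd: "AE y in M. \<bar>y\<bar> \<le> K"
    and f: "\<And>u. (f has_real_derivative f' u) (at u)"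
    and f': "continuous_on UNIV f'"
  shows "((\<lambda>z. \<integral>y. f (z - y) \<partial>M) has_real_derivative (\<integral>y. f' (z - y) \<partial>M)) (at z)"
proof -
  interpret prob_space M by fact
  have cont_f: "continuous_on UNIV f"
    using f by (meson DERIV_isCont continuous_at_imp_continuous_on)
  have [measurable]: "f \<in> borel_measurable borel" "f' \<in> borel_measurable borel"
    using cont_f f' by (auto intro: borel_measurable_continuous_onI)
  have integrable_f: "integrable M (\<lambda>y. f (x - y))" for x
  proof -
    have "compact (f ` {x - K .. x + K})"
      by (intro compact_continuous_image continuous_on_subset[OF cont_f]) auto
    then obtain B where B: "\<forall>v \<in> f ` {x - K .. x + K}. \<bar>v\<bar> \<le> B"
      using compact_imp_bounded bounded_real by metis
    have "AE y in M. norm (f (x - y)) \<le> B"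
      using bdd
    proof eventually_elim
      case (elim y)
      then have "x - y \<in> {x - K .. x + K}" by auto
      then show ?case using B by auto
    qed
    then show ?thesis by (rule integrable_const_bound) measurable
  qed
  show ?thesis
    unfolding DERIV_def tendsto_at_iff_sequentially comp_def
  proof (intro allI impI)
    fix X :: "nat \<Rightarrow> real"
    assume X: "\<forall>i. X i \<in> UNIV - {0}" "X \<longlonglongrightarrow> 0"
    \<comment> \<open>The increments converge, hence are bounded by some R; the interval from z - K
      - R to z + K + R then serves for every n.\<close>
    then obtain R where R: "\<And>n. \<bar>X n\<bar> \<le> R"
      by (metis Bseq_def convergent_def convergent_imp_Bseq real_norm_def)
    have "compact (f' ` {z - K - R .. z + K + R})"
      by (intro compact_continuous_image continuous_on_subset[OF f']) auto
    then obtain B where B: "\<forall>v \<in> f' ` {z - K - R .. z + K + R}. \<bar>v\<bar> \<le> B"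
      using compact_imp_bounded bounded_real by metis
    have "(\<lambda>n. \<integral>y. (f (z + X n - y) - f (z - y)) / X n \<partial>M) \<longlonglongrightarrow> (\<integral>y. f' (z - y) \<partial>M)"
    proof (rule integral_dominated_convergence[where w = "\<lambda>_. B"])
      show "AE y in M. (\<lambda>n. (f (z + X n - y) - f (z - y)) / X n) \<longlonglongrightarrow> f' (z - y)"
      proof (intro AE_I2)
        fix y
        show "(\<lambda>n. (f (z + X n - y) - f (z - y)) / X n) \<longlonglongrightarrow> f' (z - y)"
          using f[of "z - y"] X unfolding DERIV_def tendsto_at_iff_sequentially comp_def
          by (auto simp: algebra_simps)
      qed
      show "AE y in M. norm ((f (z + X n - y) - f (z - y)) / X n) \<le> B" for n
        using bdd
      proof eventually_elim
        case (elim y)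
        have "norm (f (z + X n - y) - f (z - y)) \<le> B * norm ((z + X n - y) - (z - y))"
        proof (rule field_differentiable_bound[where S = "{z - K - R .. z + K + R}"])
          show "(f has_field_derivative f' x) (at x within {z - K - R .. z + K + R})" for x
            using f by (rule has_field_derivative_at_within)
        qed (use B elim R[of n] in auto)
        then show ?case using X by (simp add: divide_simps)
      qed
    qed auto
    moreover have "(\<integral>y. (f (z + X n - y) - f (z - y)) / X n \<partial>M)
        = ((\<integral>y. f (z + X n - y) \<partial>M) - (\<integral>y. f (z - y) \<partial>M)) / X n" for n
      using integrable_f by simp
    ultimately show "(\<lambda>n. ((\<integral>y. f (z + X n - y) \<partial>M) - (\<integral>y. f (z - y) \<partial>M)) / X n)
        \<longlonglongrightarrow> (\<integral>y. f' (z - y) \<partial>M)" by (simp only:)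
  qed
qed

text \<open>If \<open>D\<close> were positive, the derivative, which is 0 at z, would be positive
  just to the right of z, and F would increase there.\<close>

lemma local_max_second_derivative:
  fixes F F' :: "real \<Rightarrow> real"
  assumes F: "\<And>x. (F has_real_derivative F' x) (at x)"
    and F': "(F' has_real_derivative D) (at z)"
    and max: "d > 0" "\<And>x. \<bar>x - z\<bar> < d \<Longrightarrow> F x \<le> F z"
  shows "F' z = 0" "D \<le> 0"
proof -
  show crit: "F' z = 0"
    by (rule DERIV_local_max[OF F max(1)]) (use max(2) in \<open>auto simp: abs_minus_commute\<close>)
  show "D \<le> 0"
  proof (rule ccontr)
    assume "\<not> D \<le> 0"
    then obtain e where e: "e > 0" "\<And>h. h > 0 \<Longrightarrow> h < e \<Longrightarrow> F' z < F' (z + h)"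
      using DERIV_pos_inc_right[OF F'] by auto
    define h where "h = min d e / 2"
    have h: "h > 0" "h < d" "h < e" using e max by (auto simp: h_def)
    have "F z < F (z + h)"
    proof (rule DERIV_pos_imp_increasing_open[where f = F])
      show "\<exists>y. (F has_real_derivative y) (at x) \<and> y > 0" if "z < x" "x < z + h" for x
        using e(2)[of "x - z"] that h crit F by force
      show "continuous_on {z..z + h} F"
        using F by (meson DERIV_isCont continuous_at_imp_continuous_on)
    qed (use h in auto)
    then show False using max(2)[of "z + h"] h by auto
  qed
qed

lemma local_min_second_derivative:
  fixes F F' :: "real \<Rightarrow> real"
  assumes F: "\<And>x. (F has_real_derivative F' x) (at x)"
    and F': "(F' has_real_derivative D) (at z)"
    and min: "d > 0" "\<And>x. \<bar>x - z\<bar> < d \<Longrightarrow> F z \<le> F x"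
  shows "F' z = 0" "D \<ge> 0"
  using local_max_second_derivative[of "\<lambda>x. - F x" "\<lambda>x. - F' x" "- D" z d] assms
  by (auto intro: DERIV_minus)

section \<open>The potential V: derivatives, lower bound and growth\<close>

locale interaction_potential =
  fixes p q :: real
  assumes q_ge_2: "2 \<le> q" and q_less_p: "q < p"
begin

abbreviation V :: "real \<Rightarrow> real" where "V \<equiv> Vpot p q"

definition V' :: "real \<Rightarrow> real" where
  "V' u = spow (p - 1) u - spow (q - 1) u"

definition V'' :: "real \<Rightarrow> real" where
  "V'' u = (p - 1) * apow (p - 2) u - (q - 1) * apow (q - 2) u"

lemma DERIV_V: "(V has_real_derivative V' u) (at u)"
  unfolding Vpot_def V'_def
  by (intro DERIV_diff DERIV_abs_powr) (use q_ge_2 q_less_p in auto)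

lemma DERIV_V': "(V' has_real_derivative V'' u) (at u)"
  unfolding V'_def V''_def
  using DERIV_diff[OF DERIV_spow[of "p - 1" u] DERIV_spow[of "q - 1" u]] q_ge_2 q_less_p
  by simp

lemma continuous_on_V: "continuous_on A V"
  using DERIV_V by (meson DERIV_isCont continuous_at_imp_continuous_on)

lemma continuous_on_V': "continuous_on A V'"
  using DERIV_V' by (meson DERIV_isCont continuous_at_imp_continuous_on)

lemma continuous_on_V'': "continuous_on A V''"
  unfolding V''_def using q_ge_2 q_less_p by (auto intro!: continuous_intros)

lemma measurable_V [measurable]: "V \<in> borel_measurable borel"
  and measurable_V' [measurable]: "V' \<in> borel_measurable borel"
  and measurable_V'' [measurable]: "V'' \<in> borel_measurable borel"
  by (auto intro: borel_measurable_continuous_onI continuous_on_V continuous_on_V' continuous_on_V'')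

lemma V_0 [simp]: "V 0 = 0"
  by (simp add: Vpot_def)

lemma V_minus [simp]: "V (- u) = V u"
  by (simp add: Vpot_def)

lemma V'_minus [simp]: "V' (- u) = - V' u"
  by (simp add: V'_def spow_def)

lemma V_commute: "V (x - y) = V (y - x)"
  by (metis V_minus minus_diff_eq)

lemma V_1: "V 1 < 0"
  using q_ge_2 q_less_p by (simp add: Vpot_def field_simps)

text \<open>Since -1/q is a lower bound of \<open>V\<close>, this shift is nonnegative, and between
  probability measures it changes the double integral only by the constant 1/q. Energies become
  \<open>ennreal\<close> integrals, for which Tonelli and Fatou hold without integrability.\<close>

definition W :: "real \<Rightarrow> real" where "W u = V u + 1 / q"

lemma measurable_W [measurable]: "W \<in> borel_measurable borel"
  unfolding W_def by measurable

lemma W_commute: "W (x - y) = W (y - x)"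
  unfolding W_def using V_commute by simp

text \<open>On |u| \<le> 1 the q-term alone is at most 1/q; beyond 1 the potential is nondecreasing,
  so its value at 1 bounds it from below.\<close>

lemma neg_V_le: "- V u \<le> 1 / q"
proof (cases "\<bar>u\<bar> \<le> 1")
  case True
  then have "\<bar>u\<bar> powr q \<le> 1 powr q" using q_ge_2 by (intro powr_mono2) auto
  then have "\<bar>u\<bar> powr q / q \<le> 1 / q" using q_ge_2 by (intro divide_right_mono) auto
  moreover have "0 \<le> \<bar>u\<bar> powr p / p" using q_ge_2 q_less_p by simp
  ultimately show ?thesis unfolding Vpot_def by linarith
next
  case False
  define a where "a = \<bar>u\<bar>"
  have "1 < a" using False by (simp add: a_def)
  have "V 1 \<le> V a"
  proof (rule DERIV_nonneg_imp_nondecreasing[where f = V])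
    fix x assume "1 \<le> x" "x \<le> a"
    then have "V' x \<ge> 0" using q_less_p by (auto simp: V'_def spow_def intro!: powr_mono)
    then show "\<exists>y. (V has_real_derivative y) (at x) \<and> y \<ge> 0" using DERIV_V by blast
  qed (use \<open>1 < a\<close> in auto)
  moreover have "V a = V u" by (simp add: a_def Vpot_def)
  moreover have "- V 1 \<le> 1 / q" using q_ge_2 q_less_p by (simp add: Vpot_def)
  ultimately show ?thesis by simp
qed

lemma W_nonneg: "W u \<ge> 0"
  using neg_V_le[of u] by (simp add: W_def)

text \<open>Linear growth bounds first moments, both for the compactness of a minimizer's support
  and for the tightness of a minimizing sequence.\<close>

lemma W_coercive: obtains U where "U > 0" "\<And>u. \<bar>u\<bar> \<le> W u + U"
proof -
  \<comment> \<open>Beyond the second entry of the maximum, |u|^(p-q) / p - 1/q is at least 1, hence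
    \<open>V u\<close> \<ge> |u|^q; beyond 1 this is at least |u|.\<close>
  define U where "U = max 1 ((p * (1 + 1 / q)) powr (1 / (p - q)))"
  have "\<bar>u\<bar> \<le> W u + U" for u
  proof (cases "\<bar>u\<bar> \<le> U")
    case True
    then show ?thesis using W_nonneg[of u] by simp
  next
    case False
    have c0: "p * (1 + 1 / q) > 0" using q_ge_2 q_less_p by (auto intro!: mult_pos_pos add_pos_pos)
    have u: "\<bar>u\<bar> > 1" "\<bar>u\<bar> > (p * (1 + 1 / q)) powr (1 / (p - q))"
      using False by (auto simp: U_def)
    have "p * (1 + 1 / q) = ((p * (1 + 1 / q)) powr (1 / (p - q))) powr (p - q)"
      using q_less_p c0 by (simp add: powr_powr)
    also have "\<dots> \<le> \<bar>u\<bar> powr (p - q)" using u q_less_p by (intro powr_mono2) auto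
    finally have "1 \<le> \<bar>u\<bar> powr (p - q) / p - 1 / q" using q_ge_2 q_less_p by (simp add: field_simps)
    then have "\<bar>u\<bar> powr q * 1 \<le> \<bar>u\<bar> powr q * (\<bar>u\<bar> powr (p - q) / p - 1 / q)"
      by (intro mult_left_mono) auto
    also have "\<dots> = V u" by (simp add: Vpot_def algebra_simps flip: powr_add)
    finally have "\<bar>u\<bar> powr q \<le> V u" by simp
    moreover have "\<bar>u\<bar> powr 1 \<le> \<bar>u\<bar> powr q" using u q_ge_2 by (intro powr_mono) auto
    ultimately have "\<bar>u\<bar> \<le> V u" by simp
    moreover have "V u \<le> W u" "U > 0" using q_ge_2 by (auto simp: W_def U_def)
    ultimately show ?thesis by linarith
  qed
  moreover have "U > 0" by (auto simp: U_def)
  ultimately show thesis using that by blast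
qed

end

section \<open>Variations of the energy\<close>

text \<open>The convex combination (1 - t) M + t N, written as drawing from N with probability t:
  the rules for \<open>bind\<close> then yield its sets and integrals.\<close>

definition mix :: "real \<Rightarrow> 'a measure \<Rightarrow> 'a measure \<Rightarrow> 'a measure" where
  "mix t M N = measure_pmf (bernoulli_pmf t) \<bind> (\<lambda>b. if b then N else M)"

lemma measurable_mix_kernel:
  assumes "prob_space M" "prob_space N" "sets N = sets M"
  shows "(\<lambda>b. if b then N else M) \<in> measure_pmf (bernoulli_pmf t) \<rightarrow>\<^sub>M subprob_algebra M"
  using assms by (auto simp: space_subprob_algebra prob_space_imp_subprob_space)

lemma sets_mix [simp]:
  assumes "prob_space M" "prob_space N" "sets N = sets M"
  shows "sets (mix t M N) = sets M"
  unfolding mix_def by (rule sets_bind[OF sets_kernel[OF measurable_mix_kernel[OF assms]]]) auto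

lemma nn_integral_mix:
  assumes MN: "prob_space M" "prob_space N" "sets N = sets M" and t: "0 \<le> t" "t \<le> 1"
    and f: "f \<in> borel_measurable M"
  shows "(\<integral>\<^sup>+x. f x \<partial>mix t M N) = ennreal (1 - t) * (\<integral>\<^sup>+x. f x \<partial>M) + ennreal t * (\<integral>\<^sup>+x. f x \<partial>N)"
  unfolding mix_def nn_integral_bind[OF f measurable_mix_kernel[OF MN]]
  using t by (simp add: mult.commute add.commute)

lemma emeasure_mix:
  assumes MN: "prob_space M" "prob_space N" "sets N = sets M" and t: "0 \<le> t" "t \<le> 1"
    and A: "A \<in> sets M"
  shows "emeasure (mix t M N) A = ennreal (1 - t) * emeasure M A + ennreal t * emeasure N A"
proof -
  have "A \<in> sets (mix t M N)" "A \<in> sets N" using A sets_mix[OF MN] MN(3) by auto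
  then show ?thesis using nn_integral_mix[OF MN t, of "indicator A"] A by simp
qed

lemma prob_space_mix:
  assumes MN: "prob_space M" "prob_space N" "sets N = sets M" and t: "0 \<le> t" "t \<le> 1"
  shows "prob_space (mix t M N)"
proof (rule prob_spaceI)
  have "space (mix t M N) = space M" "space N = space M"
    using sets_mix[OF MN] MN(3) by (auto dest: sets_eq_imp_space_eq)
  then show "emeasure (mix t M N) (space (mix t M N)) = 1"
    using emeasure_mix[OF MN t, of "space M"] prob_space.emeasure_space_1[OF MN(1)]
      prob_space.emeasure_space_1[OF MN(2)] t
    by (simp flip: ennreal_plus)
qed

lemma prob_R_space: "prob_R M \<Longrightarrow> prob_space M"
  and prob_R_sets: "prob_R M \<Longrightarrow> sets M = sets borel"
  by (auto simp: prob_R_def)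

lemma prob_R_mix: "prob_R M \<Longrightarrow> prob_R N \<Longrightarrow> 0 \<le> t \<Longrightarrow> t \<le> 1 \<Longrightarrow> prob_R (mix t M N)"
  by (auto simp: prob_R_def prob_space_mix)

lemma prob_R_distr: "prob_R M \<Longrightarrow> f \<in> borel \<rightarrow>\<^sub>M borel \<Longrightarrow> prob_R (distr M borel f)"
  by (auto simp: prob_R_def intro!: prob_space.prob_space_distr cong: measurable_cong_sets)

lemma prob_R_return: "prob_R (return borel x)"
  by (auto simp: prob_R_def prob_space_return)

lemma Fubini_prob_R:
  assumes "prob_R M" "prob_R N" "(\<lambda>(x, y). f x y) \<in> borel_measurable (borel \<Otimes>\<^sub>M borel)"
  shows "(\<integral>\<^sup>+x. \<integral>\<^sup>+y. f x y \<partial>N \<partial>M) = (\<integral>\<^sup>+y. \<integral>\<^sup>+x. f x y \<partial>M \<partial>N)"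
proof -
  note [measurable_cong] = prob_R_sets[OF assms(1)] prob_R_sets[OF assms(2)]
  interpret M: prob_space M by (rule prob_R_space) fact
  interpret N: prob_space N by (rule prob_R_space) fact
  interpret pair_sigma_finite M N ..
  show ?thesis
    by (rule Fubini'[symmetric]) (use assms(3) in measurable)
qed

section \<open>The energy as a symmetric bilinear form, with its first and second variation\<close>

context interaction_potential
begin

text \<open>The polarised form: on the diagonal it is twice the energy plus 1/q
  (\<open>energy_eq_cross\<close>).\<close>

definition cross :: "real measure \<Rightarrow> real measure \<Rightarrow> ennreal" where
  "cross \<mu> \<nu> = (\<integral>\<^sup>+x. \<integral>\<^sup>+y. ennreal (W (x - y)) \<partial>\<nu> \<partial>\<mu>)"

lemma measurable_potential:
  assumes "prob_R \<nu>"
  shows "(\<lambda>x. \<integral>\<^sup>+y. ennreal (W (x - y)) \<partial>\<nu>) \<in> borel_measurable borel"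
proof -
  interpret prob_space \<nu> by (rule prob_R_space) fact
  note [measurable_cong] = prob_R_sets[OF assms]
  show ?thesis by measurable
qed

lemma cross_commute:
  assumes "prob_R \<mu>" "prob_R \<nu>"
  shows "cross \<mu> \<nu> = cross \<nu> \<mu>"
  unfolding cross_def by (subst Fubini_prob_R[OF assms]) (auto simp: W_commute)

lemma cross_mix_left:
  assumes "prob_R \<mu>" "prob_R \<nu>" "prob_R \<rho>" "0 \<le> t" "t \<le> 1"
  shows "cross (mix t \<mu> \<nu>) \<rho> = ennreal (1 - t) * cross \<mu> \<rho> + ennreal t * cross \<nu> \<rho>"
  unfolding cross_def using assms measurable_potential[OF assms(3)]
  by (subst nn_integral_mix) (auto simp: prob_R_space prob_R_sets cong: measurable_cong_sets)

lemma cross_mix: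
  assumes "prob_R \<mu>" "prob_R \<nu>" "0 \<le> t" "t \<le> 1"
  shows "cross (mix t \<mu> \<nu>) (mix t \<mu> \<nu>) = ennreal ((1 - t)\<^sup>2) * cross \<mu> \<mu>
    + ennreal (2 * t * (1 - t)) * cross \<mu> \<nu> + ennreal (t\<^sup>2) * cross \<nu> \<nu>"
proof -
  note mix = prob_R_mix[OF assms]
  have "cross (mix t \<mu> \<nu>) (mix t \<mu> \<nu>)
      = ennreal (1 - t) * cross (mix t \<mu> \<nu>) \<mu> + ennreal t * cross (mix t \<mu> \<nu>) \<nu>"
    using cross_mix_left[OF assms(1,2) mix assms(3,4)] cross_commute[OF assms(1) mix]
      cross_commute[OF assms(2) mix] by simp
  also have "\<dots> = ennreal (1 - t) * ennreal (1 - t) * cross \<mu> \<mu>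
    + (ennreal (1 - t) * ennreal t + ennreal t * ennreal (1 - t)) * cross \<mu> \<nu>
    + ennreal t * ennreal t * cross \<nu> \<nu>"
    unfolding cross_mix_left[OF assms(1,2) assms(1) assms(3,4)] cross_mix_left[OF assms(1,2) assms(2) assms(3,4)]
      cross_commute[OF assms(2,1)] by (simp add: distrib_left distrib_right ac_simps)
  also have "ennreal (1 - t) * ennreal t + ennreal t * ennreal (1 - t) = ennreal (2 * t * (1 - t))"
  proof -
    have eq: "2 * t * (1 - t) = (1 - t) * t + t * (1 - t)" by (simp add: algebra_simps)
    show ?thesis unfolding eq using assms by (subst ennreal_plus) (auto simp: ennreal_mult)
  qed
  finally show ?thesis using assms by (simp add: power2_eq_square ennreal_mult)
qed

text \<open>All that the classification needs of a minimizer; shared by local and global minimizers.\<close>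
definition directional_min :: "real measure \<Rightarrow> bool" where
  "directional_min \<mu> \<longleftrightarrow> prob_R \<mu> \<and> cross \<mu> \<mu> < \<infinity> \<and>
    (\<forall>\<nu> K. prob_R \<nu> \<and> (AE x in \<nu>. \<bar>x\<bar> \<le> K) \<longrightarrow>
      (\<exists>t0>0. t0 \<le> 1 \<and> (\<forall>t. 0 < t \<and> t < t0 \<longrightarrow> cross \<mu> \<mu> \<le> cross (mix t \<mu> \<nu>) (mix t \<mu> \<nu>))))"

lemma bounded_V: obtains B where "B > 0" "\<And>u. \<bar>u\<bar> \<le> K \<Longrightarrow> \<bar>V u\<bar> \<le> B"
proof -
  have "compact (V ` {- K .. K})"
    by (intro compact_continuous_image continuous_on_V) auto
  then obtain B where "B > 0" "\<forall>v \<in> V ` {- K .. K}. \<bar>v\<bar> \<le> B"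
    using compact_imp_bounded bounded_pos real_norm_def by metis
  then show thesis by (intro that[of B]) (auto simp: abs_le_iff)
qed

lemma cross_finite:
  assumes "prob_R \<nu>" "AE x in \<nu>. \<bar>x\<bar> \<le> K"
  shows "cross \<nu> \<nu> < \<infinity>"
proof -
  interpret prob_space \<nu> by (rule prob_R_space) fact
  obtain B where B: "B > 0" "\<And>u. \<bar>u\<bar> \<le> 2 * K \<Longrightarrow> \<bar>V u\<bar> \<le> B" using bounded_V by metis
  have "cross \<nu> \<nu> \<le> (\<integral>\<^sup>+x. \<integral>\<^sup>+y. ennreal (B + 1 / q) \<partial>\<nu> \<partial>\<nu>)"
    unfolding cross_def
  proof (intro nn_integral_mono_AE, use assms(2) in eventually_elim)
    fix x assume x: "\<bar>x\<bar> \<le> K"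
    show "(\<integral>\<^sup>+y. ennreal (W (x - y)) \<partial>\<nu>) \<le> (\<integral>\<^sup>+y. ennreal (B + 1 / q) \<partial>\<nu>)"
    proof (intro nn_integral_mono_AE, use assms(2) in eventually_elim)
      fix y assume "\<bar>y\<bar> \<le> K"
      then have "\<bar>V (x - y)\<bar> \<le> B" using x by (intro B(2)) auto
      then show "ennreal (W (x - y)) \<le> ennreal (B + 1 / q)" by (auto simp: W_def intro!: ennreal_leI)
    qed
  qed
  also have "\<dots> < \<infinity>" by (simp add: emeasure_space_1)
  finally show ?thesis .
qed

text \<open>With a, c, d for the three values of \<open>cross\<close>, minimality along the mixture
  reads 0 \<le> 2 (c - a) + t (a - 2 c + d) after division by t. Small t gives the first claim; if c
  = a, any admissible t gives the second. The bound t0 may depend on \<nu>, because it comes from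
  how fast the mixture leaves \<mu> in the Wasserstein distance.\<close>

lemma directional_min_variations:
  assumes min: "directional_min \<mu>" and \<nu>: "prob_R \<nu>" "AE x in \<nu>. \<bar>x\<bar> \<le> K"
  shows "cross \<mu> \<mu> \<le> cross \<mu> \<nu>"
    and "cross \<mu> \<nu> = cross \<mu> \<mu> \<Longrightarrow> cross \<mu> \<mu> \<le> cross \<nu> \<nu>"
proof -
  have \<mu>: "prob_R \<mu>" and fin: "cross \<mu> \<mu> < \<infinity>"
    using min by (auto simp: directional_min_def)
  obtain t0 where t0: "t0 > 0" "t0 \<le> 1"
    "\<And>t. 0 < t \<Longrightarrow> t < t0 \<Longrightarrow> cross \<mu> \<mu> \<le> cross (mix t \<mu> \<nu>) (mix t \<mu> \<nu>)"
    using min \<nu> unfolding directional_min_def by blast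
  define a d where "a = enn2real (cross \<mu> \<mu>)" and "d = enn2real (cross \<nu> \<nu>)"
  have a: "cross \<mu> \<mu> = ennreal a" "a \<ge> 0" using fin by (auto simp: a_def less_top)
  have d: "cross \<nu> \<nu> = ennreal d" "d \<ge> 0" using cross_finite[OF \<nu>] by (auto simp: d_def less_top)
  have expand: "0 \<le> 2 * (c - a) + t * (a - 2 * c + d)"
    if c: "cross \<mu> \<nu> = ennreal c" "c \<ge> 0" and t: "0 < t" "t < t0" for c t
  proof -
    have t1: "0 \<le> t" "t \<le> 1" using t t0 by auto
    have "ennreal a \<le> ennreal ((1 - t)\<^sup>2) * ennreal a + ennreal (2 * t * (1 - t)) * ennreal c
        + ennreal (t\<^sup>2) * ennreal d"
      using t0(3)[OF t] unfolding cross_mix[OF \<mu> \<nu>(1) t1] c a(1) d(1) .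
    also have "\<dots> = ennreal ((1 - t)\<^sup>2 * a + 2 * t * (1 - t) * c + t\<^sup>2 * d)"
      using a c d t1 by (simp add: ennreal_mult ennreal_plus)
    finally have "a \<le> (1 - t)\<^sup>2 * a + 2 * t * (1 - t) * c + t\<^sup>2 * d"
      using a c d t1 by (subst (asm) ennreal_le_iff) auto
    then have "0 \<le> t * (2 * (c - a) + t * (a - 2 * c + d))"
      by (simp add: algebra_simps power2_eq_square)
    then show ?thesis using t by (simp add: zero_le_mult_iff)
  qed
  show "cross \<mu> \<mu> \<le> cross \<mu> \<nu>"
  proof (cases "cross \<mu> \<nu>")
    case (real c)
    show ?thesis
    proof (rule ccontr)
      assume "\<not> ?thesis"
      then have less: "c < a" using real a by (simp add: not_le ennreal_less_iff)
      \<comment> \<open>X dominates the coefficient of t, so t \<le> (a - c) / X leaves at most c -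
        a < 0.\<close>
      define X where "X = \<bar>a - 2 * c + d\<bar> + 1"
      define t where "t = min (t0 / 2) ((a - c) / X)"
      have X: "X > 0" "a - 2 * c + d \<le> X" by (auto simp: X_def)
      have t: "0 < t" "t < t0" using t0 less X by (auto simp: t_def)
      have "t * (a - 2 * c + d) \<le> t * X" using t X by (intro mult_left_mono) auto
      also have "\<dots> \<le> (a - c) / X * X" using X by (intro mult_right_mono) (auto simp: t_def)
      also have "\<dots> = a - c" using X by simp
      finally show False using expand[OF _ _ t, of c] real less by simp
    qed
  qed simp
  show "cross \<mu> \<mu> \<le> cross \<nu> \<nu>" if eq: "cross \<mu> \<nu> = cross \<mu> \<mu>"
  proof -
    have "0 \<le> 2 * (a - a) + t0 / 2 * (a - 2 * a + d)"
      by (rule expand) (use eq a t0 in auto)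
    then have "a \<le> d" using t0 by (simp add: zero_le_mult_iff)
    then show ?thesis using a d by simp
  qed
qed

lemma cross_return: "prob_R \<mu> \<Longrightarrow> cross \<mu> (return borel x) = (\<integral>\<^sup>+y. ennreal (W (x - y)) \<partial>\<mu>)"
  by (subst cross_commute) (auto simp: cross_def nn_integral_return measurable_potential prob_R_return)

text \<open>Dirac masses as competitors give the lower bound at every point. The \<mu>-average of
  the potential is \<open>cross \<mu> \<mu>\<close> itself, so the nonnegative excess integrates to
  0.\<close>

lemma directional_min_potential:
  assumes min: "directional_min \<mu>"
  shows "cross \<mu> \<mu> \<le> (\<integral>\<^sup>+y. ennreal (W (x - y)) \<partial>\<mu>)"
    and "AE x in \<mu>. (\<integral>\<^sup>+y. ennreal (W (x - y)) \<partial>\<mu>) = cross \<mu> \<mu>"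
proof -
  have \<mu>: "prob_R \<mu>" and fin: "cross \<mu> \<mu> < \<infinity>"
    using min by (auto simp: directional_min_def)
  interpret prob_space \<mu> by (rule prob_R_space) fact
  note [measurable_cong] = prob_R_sets[OF \<mu>]
  show le: "cross \<mu> \<mu> \<le> (\<integral>\<^sup>+y. ennreal (W (x - y)) \<partial>\<mu>)" for x
    using directional_min_variations(1)[OF min prob_R_return[of x], of "\<bar>x\<bar>"]
    by (simp add: cross_return[OF \<mu>] AE_return)
  note meas [measurable] = measurable_potential[OF \<mu>]
  have "(\<integral>\<^sup>+x. (\<integral>\<^sup>+y. ennreal (W (x - y)) \<partial>\<mu>) - cross \<mu> \<mu> \<partial>\<mu>)
      = (\<integral>\<^sup>+x. (\<integral>\<^sup>+y. ennreal (W (x - y)) \<partial>\<mu>) \<partial>\<mu>) - (\<integral>\<^sup>+x. cross \<mu> \<mu> \<partial>\<mu>)"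
    by (rule nn_integral_diff) (use fin le in \<open>auto simp: emeasure_space_1\<close>)
  also have "\<dots> = 0"
    using fin by (simp add: emeasure_space_1 flip: cross_def)
  finally have "AE x in \<mu>. (\<integral>\<^sup>+y. ennreal (W (x - y)) \<partial>\<mu>) - cross \<mu> \<mu> = 0"
    by (subst (asm) nn_integral_0_iff_AE) auto
  then show "AE x in \<mu>. (\<integral>\<^sup>+y. ennreal (W (x - y)) \<partial>\<mu>) = cross \<mu> \<mu>"
  proof eventually_elim
    case (elim x)
    then show ?case using le[of x] fin by (auto simp: diff_eq_0_iff_ennreal intro: antisym)
  qed
qed

text \<open>Almost every point has W-potential \<open>cross \<mu> \<mu>\<close>, hence a mean
  distance to \<mu> of at most a + U by \<open>W_coercive\<close>. Averaging the triangle inequality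
  through a third point puts any two such points within 2 (a + U).\<close>

lemma directional_min_compact:
  assumes min: "directional_min \<mu>"
  obtains K where "AE x in \<mu>. \<bar>x\<bar> \<le> K"
proof -
  have \<mu>: "prob_R \<mu>" and fin: "cross \<mu> \<mu> < \<infinity>"
    using min by (auto simp: directional_min_def)
  interpret prob_space \<mu> by (rule prob_R_space) fact
  note [measurable_cong] = prob_R_sets[OF \<mu>]
  obtain U where U: "U > 0" "\<And>u. \<bar>u\<bar> \<le> W u + U" using W_coercive by metis
  define a where "a = enn2real (cross \<mu> \<mu>)"
  have a: "cross \<mu> \<mu> = ennreal a" "a \<ge> 0" using fin by (auto simp: a_def less_top)
  have dist_le: "(\<integral>\<^sup>+y. ennreal \<bar>x - y\<bar> \<partial>\<mu>) \<le> ennreal (a + U)"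
    if "(\<integral>\<^sup>+y. ennreal (W (x - y)) \<partial>\<mu>) = cross \<mu> \<mu>" for x
  proof -
    have "(\<integral>\<^sup>+y. ennreal \<bar>x - y\<bar> \<partial>\<mu>) \<le> (\<integral>\<^sup>+y. ennreal (W (x - y)) + ennreal U \<partial>\<mu>)"
      using U W_nonneg by (intro nn_integral_mono) (simp flip: ennreal_plus)
    also have "\<dots> = cross \<mu> \<mu> + ennreal U"
      using that by (subst nn_integral_add) (auto simp: emeasure_space_1)
    finally show ?thesis using a U by simp
  qed
  obtain x0 where x0: "(\<integral>\<^sup>+y. ennreal (W (x0 - y)) \<partial>\<mu>) = cross \<mu> \<mu>"
    using directional_min_potential(2)[OF min] AE_False eventually_mono by blast
  have "AE x in \<mu>. \<bar>x\<bar> \<le> \<bar>x0\<bar> + 2 * (a + U)"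
    using directional_min_potential(2)[OF min]
  proof eventually_elim
    case (elim x)
    have "ennreal \<bar>x - x0\<bar> = (\<integral>\<^sup>+y. ennreal \<bar>x - x0\<bar> \<partial>\<mu>)" by (simp add: emeasure_space_1)
    also have "\<dots> \<le> (\<integral>\<^sup>+y. ennreal \<bar>x - y\<bar> + ennreal \<bar>x0 - y\<bar> \<partial>\<mu>)"
      by (intro nn_integral_mono) (auto simp flip: ennreal_plus)
    also have "\<dots> = (\<integral>\<^sup>+y. ennreal \<bar>x - y\<bar> \<partial>\<mu>) + (\<integral>\<^sup>+y. ennreal \<bar>x0 - y\<bar> \<partial>\<mu>)"
      by (rule nn_integral_add) auto
    also have "\<dots> \<le> ennreal (a + U) + ennreal (a + U)"
      by (intro add_mono dist_le elim x0)
    also have "\<dots> = ennreal (2 * (a + U))" using a U by (simp flip: ennreal_plus)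
    finally have "\<bar>x - x0\<bar> \<le> 2 * (a + U)" using a U by (subst (asm) ennreal_le_iff) auto
    then show ?case by linarith
  qed
  then show thesis by (rule that)
qed

end

section \<open>Support of a minimizer\<close>

definition msupport :: "'a::metric_space measure \<Rightarrow> 'a set" where
  "msupport M = {x. \<forall>e>0. emeasure M (ball x e) \<noteq> 0}"

lemma closed_msupport: 
  fixes M :: "'a::metric_space measure"
  assumes "sets M = sets borel"
  shows "closed (msupport M)"
proof -
  have "open (- msupport M)"
    unfolding open_contains_ball
  proof
    fix x assume "x \<in> - msupport M"
    then obtain e where e: "e > 0" "emeasure M (ball x e) = 0" by (auto simp: msupport_def)
    have "y \<in> - msupport M" if "y \<in> ball x (e / 2)" for y
    proof -
      have "dist x z < e" if "z \<in> ball y (e / 2)" for z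
        using that \<open>y \<in> ball x (e / 2)\<close> dist_triangle_less_add[of x y "e / 2" z "e / 2"]
        by (auto simp: dist_commute)
      then have "ball y (e / 2) \<subseteq> ball x e" by auto
      then have "emeasure M (ball y (e / 2)) \<le> emeasure M (ball x e)"
        using assms by (intro emeasure_mono) auto
      then show ?thesis using e by (auto simp: msupport_def intro!: exI[of _ "e / 2"])
    qed
    then show "\<exists>e>0. ball x e \<subseteq> - msupport M" using e by (intro exI[of _ "e / 2"]) auto
  qed
  then show ?thesis by (simp add: closed_def)
qed

text \<open>The complement is a union of null balls; Lindelof extracts a countable subfamily with
  the same union.\<close>

lemma AE_msupport:
  fixes M :: "'a::{metric_space, second_countable_topology} measure"
  assumes "sets M = sets borel"
  shows "AE x in M. x \<in> msupport M"
proof -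
  define F where "F = {ball x e | x e. e > 0 \<and> emeasure M (ball x e) = 0}"
  have "\<And>U. U \<in> F \<Longrightarrow> open U" by (auto simp: F_def)
  then obtain F' where F': "F' \<subseteq> F" "countable F'" "\<Union> F' = \<Union> F" by (rule Lindelof)
  have "(\<Union>U\<in>F'. U) \<in> null_sets M"
    using F' assms by (intro null_sets_UN') (auto simp: F_def null_sets_def)
  then have "\<Union> F \<in> null_sets M" using F' by simp
  moreover have "- msupport M \<subseteq> \<Union> F"
    by (force simp: F_def msupport_def)
  ultimately show ?thesis by (intro AE_I'[of "\<Union> F"]) auto
qed

context interaction_potential
begin

text \<open>The Bochner integral is 0 for a non-integrable function, so this real-valued V * \<mu>
  is meant for measures of bounded support.\<close>

definition pot :: "real measure \<Rightarrow> real \<Rightarrow> real" where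
  "pot \<mu> z = (\<integral>y. V (z - y) \<partial>\<mu>)"

lemma integrable_bounded_support:
  fixes f :: "real \<Rightarrow> real"
  assumes "prob_R \<mu>" "AE y in \<mu>. \<bar>y\<bar> \<le> K" "continuous_on UNIV f"
  shows "integrable \<mu> f"
proof -
  interpret prob_space \<mu> by (rule prob_R_space) fact
  note [measurable_cong] = prob_R_sets[OF assms(1)]
  have [measurable]: "f \<in> borel_measurable borel"
    using assms by (auto intro: borel_measurable_continuous_onI)
  have "compact (f ` {- K .. K})"
    by (intro compact_continuous_image continuous_on_subset[OF assms(3)]) auto
  then obtain B where B: "\<forall>v \<in> f ` {- K .. K}. \<bar>v\<bar> \<le> B"
    using compact_imp_bounded bounded_real by metis
  have "AE y in \<mu>. norm (f y) \<le> B"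
    using assms(2)
  proof eventually_elim
    case (elim y)
    then have "y \<in> {- K .. K}" by auto
    then show ?case using B by auto
  qed
  then show ?thesis by (rule integrable_const_bound) measurable
qed

lemma integrable_V:
  assumes "prob_R \<mu>" "AE y in \<mu>. \<bar>y\<bar> \<le> K"
  shows "integrable \<mu> (\<lambda>y. V (z - y))"
  by (rule integrable_bounded_support[OF assms])
    (auto intro!: continuous_intros continuous_on_compose2[OF continuous_on_V])

lemma DERIV_pot:
  assumes "prob_R \<mu>" "AE y in \<mu>. \<bar>y\<bar> \<le> K"
  shows "(pot \<mu> has_real_derivative (\<integral>y. V' (z - y) \<partial>\<mu>)) (at z)"
  unfolding pot_def using assms DERIV_V continuous_on_V'
  by (intro DERIV_convolution) (auto simp: prob_R_def)

lemma DERIV_pot':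
  assumes "prob_R \<mu>" "AE y in \<mu>. \<bar>y\<bar> \<le> K"
  shows "((\<lambda>z. \<integral>y. V' (z - y) \<partial>\<mu>) has_real_derivative (\<integral>y. V'' (z - y) \<partial>\<mu>)) (at z)"
  using assms DERIV_V' continuous_on_V''
  by (intro DERIV_convolution) (auto simp: prob_R_def)

lemma continuous_on_pot:
  assumes "prob_R \<mu>" "AE y in \<mu>. \<bar>y\<bar> \<le> K"
  shows "continuous_on A (pot \<mu>)"
  using DERIV_pot[OF assms] by (meson DERIV_isCont continuous_at_imp_continuous_on)

lemma nn_integral_W:
  assumes "prob_R \<mu>" "AE y in \<mu>. \<bar>y\<bar> \<le> K"
  shows "(\<integral>\<^sup>+y. ennreal (W (z - y)) \<partial>\<mu>) = ennreal (pot \<mu> z + 1 / q)" "pot \<mu> z + 1 / q \<ge> 0"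
proof -
  interpret prob_space \<mu> by (rule prob_R_space) fact
  note int = integrable_V[OF assms, of z]
  have eq: "(\<integral>y. W (z - y) \<partial>\<mu>) = pot \<mu> z + 1 / q"
    using int by (simp add: W_def pot_def prob_space)
  show "(\<integral>\<^sup>+y. ennreal (W (z - y)) \<partial>\<mu>) = ennreal (pot \<mu> z + 1 / q)"
    using int by (subst nn_integral_eq_integral) (auto simp: W_nonneg eq, simp add: W_def)
  show "pot \<mu> z + 1 / q \<ge> 0" unfolding eq[symmetric] by (simp add: W_nonneg)
qed

lemma cross_eq_integral:
  assumes \<mu>: "prob_R \<mu>" "AE y in \<mu>. \<bar>y\<bar> \<le> K" and \<nu>: "prob_R \<nu>" "AE y in \<nu>. \<bar>y\<bar> \<le> L"
  shows "cross \<mu> \<nu> = ennreal ((\<integral>x. pot \<nu> x \<partial>\<mu>) + 1 / q)" "(\<integral>x. pot \<nu> x \<partial>\<mu>) + 1 / q \<ge> 0"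
proof -
  interpret prob_space \<mu> by (rule prob_R_space) fact
  have int: "integrable \<mu> (pot \<nu>)"
    by (rule integrable_bounded_support[OF \<mu> continuous_on_pot[OF \<nu>]])
  have eq: "(\<integral>x. pot \<nu> x + 1 / q \<partial>\<mu>) = (\<integral>x. pot \<nu> x \<partial>\<mu>) + 1 / q"
    using int by (simp add: prob_space)
  show "cross \<mu> \<nu> = ennreal ((\<integral>x. pot \<nu> x \<partial>\<mu>) + 1 / q)"
    unfolding cross_def nn_integral_W(1)[OF \<nu>] eq[symmetric]
    using int by (subst nn_integral_eq_integral) (auto simp: nn_integral_W(2)[OF \<nu>])
  show "(\<integral>x. pot \<nu> x \<partial>\<mu>) + 1 / q \<ge> 0"
    unfolding eq[symmetric] by (simp add: nn_integral_W(2)[OF \<nu>])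
qed

lemma V_nonpos: "\<bar>u\<bar> \<le> 1 \<Longrightarrow> V u \<le> 0"
proof -
  assume u: "\<bar>u\<bar> \<le> 1"
  have "\<bar>u\<bar> powr p / p \<le> \<bar>u\<bar> powr q / q"
    using u q_ge_2 q_less_p by (intro frac_le powr_mono') auto
  then show "V u \<le> 0" by (simp add: Vpot_def)
qed

text \<open>If V (x - y) were positive, collapsing a small ball around y to the point x would lower the
  energy: the first variation vanishes and the second one is negative.\<close>
lemma msupport_V_nonpos:
  assumes \<mu>: "prob_R \<mu>" and bdd: "AE x in \<mu>. \<bar>x\<bar> \<le> K" and C: "AE x in \<mu>. pot \<mu> x = C"
    and second: "\<And>\<nu> L. prob_R \<nu> \<Longrightarrow> AE x in \<nu>. \<bar>x\<bar> \<le> L \<Longrightarrow> AE x in \<nu>. pot \<mu> x = C \<Longrightarrow>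
      C \<le> (\<integral>x. pot \<nu> x \<partial>\<nu>)"
    and x: "pot \<mu> x = C" and y: "y \<in> msupport \<mu>"
  shows "V (x - y) \<le> 0"
proof (rule ccontr)
  assume "\<not> V (x - y) \<le> 0"
  define \<eta> where "\<eta> = V (x - y) / 2"
  have \<eta>: "\<eta> > 0" "\<eta> < V (x - y)" using \<open>\<not> V (x - y) \<le> 0\<close> by (auto simp: \<eta>_def)
  interpret prob_space \<mu> by (rule prob_R_space) fact
  interpret P: pair_prob_space \<mu> \<mu> ..
  note [measurable_cong] = prob_R_sets[OF \<mu>]
  have "isCont (\<lambda>w. V (x - w)) y"
    using continuous_on_compose2[OF continuous_on_V[of UNIV], of UNIV "\<lambda>w. x - w"]
    by (auto intro!: continuous_intros simp: continuous_on_eq_continuous_at)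
  then have "eventually (\<lambda>w. V (x - w) > \<eta>) (at y)"
    unfolding isCont_def by (rule order_tendstoD) (rule \<eta>)
  then obtain d where d: "d > 0" "\<And>w. w \<noteq> y \<Longrightarrow> dist w y < d \<Longrightarrow> V (x - w) > \<eta>"
    unfolding eventually_at by auto
  \<comment> \<open>Radius at most 1/2 keeps any two points of the ball within distance 1, where
    \<open>V\<close> is nonpositive.\<close>
  define e where "e = min d (1 / 2)"
  define B where "B = ball y e"
  have e: "e > 0" "e \<le> d" "e \<le> 1 / 2" using d by (auto simp: e_def)
  have [measurable]: "B \<in> sets borel" by (simp add: B_def)
  have V_B: "V (x - w) \<ge> \<eta>" if "w \<in> B" for w
    using that d(2)[of w] e \<eta> by (cases "w = y") (auto simp: B_def dist_commute)
  have V_BB: "V (z - w) \<le> 0" if "z \<in> B" "w \<in> B" for z w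
    using that e by (intro V_nonpos) (auto simp: B_def dist_real_def)
  have "emeasure \<mu> B \<noteq> 0" using y e by (auto simp: msupport_def B_def)
  define s where "s = measure \<mu> B"
  have s: "s > 0" using \<open>emeasure \<mu> B \<noteq> 0\<close> by (simp add: s_def emeasure_eq_measure zero_less_measure_iff)
  define T where "T z = (if z \<in> B then x else z)" for z
  have [measurable]: "T \<in> borel \<rightarrow>\<^sub>M borel" unfolding T_def by measurable
  define I :: "real \<Rightarrow> real" where "I = indicator B"
  have [measurable]: "I \<in> borel_measurable borel" unfolding I_def by measurable
  have I01: "0 \<le> I z" "I z \<le> 1" for z by (auto simp: I_def indicator_def)
  define \<nu> where "\<nu> = distr \<mu> borel T"
  define L where "L = max K \<bar>x\<bar>"
  have \<nu>: "prob_R \<nu>" unfolding \<nu>_def by (rule prob_R_distr[OF \<mu>]) measurable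
  have bdd_T: "AE z in \<mu>. \<bar>T z\<bar> \<le> L" using bdd by eventually_elim (auto simp: T_def L_def)
  then have bdd_\<nu>: "AE z in \<nu>. \<bar>z\<bar> \<le> L" unfolding \<nu>_def by (subst AE_distr_iff) auto
  \<comment> \<open>The collapsed measure still lives where the potential of \<mu> equals C, so its
    first variation vanishes and \<open>second\<close> applies.\<close>
  have pot_T: "AE z in \<mu>. pot \<mu> (T z) = C" using C by eventually_elim (auto simp: T_def x)
  have meas_pot [measurable]: "pot \<mu> \<in> borel_measurable borel"
    by (rule borel_measurable_continuous_onI[OF continuous_on_pot[OF \<mu> bdd]])
  have meas_pot' [measurable]: "pot \<nu> \<in> borel_measurable borel"
    by (rule borel_measurable_continuous_onI[OF continuous_on_pot[OF \<nu> bdd_\<nu>]])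
  have "AE z in \<nu>. pot \<mu> z = C" unfolding \<nu>_def by (subst AE_distr_iff) (use pot_T in auto)
  from second[OF \<nu> bdd_\<nu> this] have "C \<le> (\<integral>z. pot \<nu> z \<partial>\<nu>)" .
  also have "\<dots> = (\<integral>z. pot \<nu> (T z) \<partial>\<mu>)"
  proof -
    have "(\<integral>z. pot \<nu> z \<partial>distr \<mu> borel T) = (\<integral>z. pot \<nu> (T z) \<partial>\<mu>)"
      by (rule integral_distr) measurable
    then show ?thesis by (simp only: \<nu>_def[symmetric])
  qed
  finally have lower: "C \<le> (\<integral>z. pot \<nu> (T z) \<partial>\<mu>)" .
  have intV: "integrable \<mu> (\<lambda>w. V (z - w))" for z by (rule integrable_V[OF \<mu> bdd])
  have intVI: "integrable \<mu> (\<lambda>w. V (z - w) * I w)" for z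
    by (rule Bochner_Integration.integrable_bound[OF intV[of z]])
      (auto simp: abs_mult I01 mult_left_le)
  have intI: "integrable \<mu> I"
    by (rule integrable_const_bound[where B = 1]) (auto simp: I01)
  have int_I: "(\<integral>w. I w \<partial>\<mu>) = s" unfolding I_def s_def by simp
  \<comment> \<open>The share of the potential that the ball produces at z; collapsing the ball
    replaces it by s V (z - x).\<close>
  define G where "G z = (\<integral>w. V (z - w) * I w \<partial>\<mu>)" for z
  have pot_\<nu>: "pot \<nu> z = pot \<mu> z - G z + s * V (z - x)" for z
  proof -
    have "pot \<nu> z = (\<integral>w. V (z - T w) \<partial>\<mu>)"
      unfolding pot_def \<nu>_def by (rule integral_distr) measurable
    also have "\<dots> = (\<integral>w. V (z - w) - V (z - w) * I w + I w * V (z - x) \<partial>\<mu>)"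
      by (rule Bochner_Integration.integral_cong) (auto simp: T_def I_def)
    also have "\<dots> = pot \<mu> z - G z + s * V (z - x)"
      using intV intVI intI int_I by (simp add: pot_def G_def)
    finally show ?thesis .
  qed
  obtain M where M: "M > 0" "\<And>u. \<bar>u\<bar> \<le> 2 * K \<Longrightarrow> \<bar>V u\<bar> \<le> M" using bounded_V by metis
  have bddP: "AE zw in \<mu> \<Otimes>\<^sub>M \<mu>. \<bar>V (fst zw - snd zw)\<bar> \<le> M"
  proof (rule P.AE_pair_measure)
    show "AE z in \<mu>. AE w in \<mu>. \<bar>V (fst (z, w) - snd (z, w))\<bar> \<le> M"
      using bdd
    proof eventually_elim
      case (elim z)
      note z = elim
      show ?case using bdd by eventually_elim (use z in \<open>auto intro!: M\<close>)
    qed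
  qed measurable
  have intP: "integrable (\<mu> \<Otimes>\<^sub>M \<mu>) (\<lambda>(z, w). V (z - w) * I w)"
  proof (rule P.integrable_const_bound[where B = M])
    show "AE zw in \<mu> \<Otimes>\<^sub>M \<mu>. norm (case zw of (z, w) \<Rightarrow> V (z - w) * I w) \<le> M"
      using bddP
    proof eventually_elim
      case (elim zw)
      have "\<bar>V (fst zw - snd zw)\<bar> * I (snd zw) \<le> M * 1"
        using elim I01 by (intro mult_mono) auto
      then show ?case by (auto simp: abs_mult I01 split: prod.split)
    qed
  qed measurable
  have intG: "integrable \<mu> G" unfolding G_def using P.integrable_fst[OF intP] by simp
  have int_G: "(\<integral>z. G z \<partial>\<mu>) = s * C"
  proof -
    have "(\<integral>z. G z \<partial>\<mu>) = (\<integral>w. (\<integral>z. V (z - w) * I w \<partial>\<mu>) \<partial>\<mu>)"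
      unfolding G_def by (rule P.Fubini_integral[OF intP, symmetric])
    also have "\<dots> = (\<integral>w. pot \<mu> w * I w \<partial>\<mu>)"
      unfolding pot_def by (simp add: V_commute)
    also have "\<dots> = (\<integral>w. C * I w \<partial>\<mu>)"
      by (rule integral_cong_AE) (use C in auto)
    finally show ?thesis using int_I by simp
  qed
  have [measurable]: "G \<in> borel_measurable borel"
    using intG prob_R_sets[OF \<mu>] by (auto dest: borel_measurable_integrable cong: measurable_cong_sets)
  have intIG: "integrable \<mu> (\<lambda>z. I z * G z)"
    by (rule Bochner_Integration.integrable_bound[OF intG])
      (auto simp: abs_mult I01 mult_le_cancel_right1 intro!: mult_left_le_one_le)
  \<comment> \<open>On the ball the integrand is C - G x because V 0 = 0; off the ball it is C - G z
    + s V (x - z). The terms with I merge the two cases.\<close>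
  have "(\<integral>z. pot \<nu> (T z) \<partial>\<mu>) = (\<integral>z. (C - G z + s * V (x - z)) + I z * G z - I z * G x
      - s * (V (x - z) * I z) \<partial>\<mu>)"
  proof (rule integral_cong_AE)
    show "AE z in \<mu>. pot \<nu> (T z) = (C - G z + s * V (x - z)) + I z * G z - I z * G x
      - s * (V (x - z) * I z)"
      using C
    proof eventually_elim
      case (elim z)
      show ?case
      proof (cases "z \<in> B")
        case True
        then show ?thesis using x by (simp add: pot_\<nu> T_def I_def)
      next
        case False
        then show ?thesis using elim V_commute[of x z] by (simp add: pot_\<nu> T_def I_def)
      qed
    qed
  qed measurable
  also have "\<dots> = C - s * C + s * pot \<mu> x + (\<integral>z. I z * G z \<partial>\<mu>) - s * G x - s * G x"
    using intG int_G intIG intV intVI intI int_I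
    by (simp add: prob_space pot_def) (simp add: G_def)
  also have "\<dots> = C + (\<integral>z. I z * G z \<partial>\<mu>) - 2 * s * G x" using x by simp
  \<comment> \<open>The right side is the self-interaction of the ball, nonpositive since the ball
    is small, whereas \<open>G x\<close> is at least \<eta> s > 0: this is the
    contradiction.\<close>
  finally have "2 * s * G x \<le> (\<integral>z. I z * G z \<partial>\<mu>)" using lower by simp
  also have "\<dots> \<le> 0"
  proof -
    have "I z * G z \<le> 0" for z
    proof (cases "z \<in> B")
      case True
      have "V (z - w) * I w \<le> 0" for w
        using V_BB[OF True] by (auto simp: I_def indicator_def)
      then have "G z \<le> 0" unfolding G_def
        using integral_nonneg_AE[of "\<lambda>w. - (V (z - w) * I w)" \<mu>] by simp
      then show ?thesis by (simp add: I01 mult_nonneg_nonpos)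
    qed (simp add: I_def)
    then show ?thesis using integral_nonneg_AE[of "\<lambda>z. - (I z * G z)" \<mu>] by simp
  qed
  finally have "G x \<le> 0" using s by (simp add: mult_le_0_iff)
  moreover have "\<eta> * s \<le> G x"
  proof -
    have "(\<integral>w. \<eta> * I w \<partial>\<mu>) \<le> G x"
      unfolding G_def
    proof (rule integral_mono)
      show "\<eta> * I w \<le> V (x - w) * I w" for w
        using V_B[of w] by (auto simp: I_def indicator_def)
    qed (use intVI intI in auto)
    then show ?thesis using int_I by simp
  qed
  moreover have "0 < \<eta> * s" using s \<eta> by simp
  ultimately show False by linarith
qed

end

text \<open>What survives of minimality: the Euler-Lagrange conditions with constant C, and the sign
  condition from the second variation. Stated for a compact set S that carries \<mu>, they pass to
  the reflected measure at once.\<close>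

locale equilibrium = interaction_potential +
  fixes \<mu> :: "real measure" and S :: "real set" and C :: real
  assumes prob_R: "prob_R \<mu>" and compact_S: "compact S" and AE_S: "AE x in \<mu>. x \<in> S"
    and pot_ge: "\<And>z. C \<le> pot \<mu> z" and pot_eq: "\<And>x. x \<in> S \<Longrightarrow> pot \<mu> x = C"
    and V_le: "\<And>x y. x \<in> S \<Longrightarrow> y \<in> S \<Longrightarrow> V (x - y) \<le> 0"

text \<open>The bound and the identity for the potential are so far known almost everywhere. Each is
  violated on an open set, and an open null set misses the support, so both hold at every support
  point.\<close>

lemma (in interaction_potential) directional_min_equilibrium:
  assumes min: "directional_min \<mu>"
  obtains S C where "equilibrium p q \<mu> S C"
proof -
  have \<mu>: "prob_R \<mu>" and fin: "cross \<mu> \<mu> < \<infinity>"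
    using min by (auto simp: directional_min_def)
  obtain K where K: "AE x in \<mu>. \<bar>x\<bar> \<le> K" using directional_min_compact[OF min] .
  define C where "C = (\<integral>x. pot \<mu> x \<partial>\<mu>)"
  have C: "cross \<mu> \<mu> = ennreal (C + 1 / q)" "C + 1 / q \<ge> 0"
    using cross_eq_integral[OF \<mu> K \<mu> K] by (auto simp: C_def)
  have ge: "C \<le> pot \<mu> z" for z
    using directional_min_potential(1)[OF min, of z] nn_integral_W[OF \<mu> K, of z] C
    by (simp add: ennreal_le_iff)
  have eq: "AE x in \<mu>. pot \<mu> x = C"
    using directional_min_potential(2)[OF min]
  proof eventually_elim
    case (elim x)
    then show ?case using nn_integral_W[OF \<mu> K, of x] C by (simp add: ennreal_inj)
  qed
  have second: "C \<le> (\<integral>x. pot \<nu> x \<partial>\<nu>)"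
    if \<nu>: "prob_R \<nu>" and L: "AE x in \<nu>. \<bar>x\<bar> \<le> L" and eq\<nu>: "AE x in \<nu>. pot \<mu> x = C" for \<nu> L
  proof -
    interpret \<nu>: prob_space \<nu> by (rule prob_R_space) fact
    have "(\<integral>x. pot \<mu> x \<partial>\<nu>) = (\<integral>x. C \<partial>\<nu>)"
      using integrable_bounded_support[OF \<nu> L continuous_on_pot[OF \<mu> K]]
      by (intro integral_cong_AE) (use eq\<nu> in auto)
    then have "cross \<nu> \<mu> = cross \<mu> \<mu>"
      using cross_eq_integral(1)[OF \<nu> L \<mu> K] C by (simp add: \<nu>.prob_space)
    then have "cross \<mu> \<mu> \<le> cross \<nu> \<nu>"
      using directional_min_variations(2)[OF min \<nu> L] cross_commute[OF \<mu> \<nu>] by simp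
    then show ?thesis using cross_eq_integral[OF \<nu> L \<nu> L] C by (simp add: ennreal_le_iff)
  qed
  have supp_K: "\<bar>x\<bar> \<le> K" if "x \<in> msupport \<mu>" for x
  proof (rule ccontr)
    assume "\<not> \<bar>x\<bar> \<le> K"
    define e where "e = \<bar>x\<bar> - K"
    have "e > 0" using \<open>\<not> \<bar>x\<bar> \<le> K\<close> by (simp add: e_def)
    have "AE y in \<mu>. y \<notin> ball x e"
      using K by eventually_elim (auto simp: e_def dist_real_def)
    then have "emeasure \<mu> (ball x e) = 0"
      using prob_R_sets[OF \<mu>] by (subst (asm) AE_iff_measurable[OF _ refl]) (auto simp: sets_eq_imp_space_eq ball_def)
    then show False using that \<open>e > 0\<close> by (auto simp: msupport_def)
  qed
  have supp_eq: "pot \<mu> x = C" if "x \<in> msupport \<mu>" for x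
  proof (rule ccontr)
    assume "pot \<mu> x \<noteq> C"
    have "open (pot \<mu> -` (- {C}))"
      by (intro open_vimage continuous_on_pot[OF \<mu> K]) auto
    then obtain e where e: "e > 0" "ball x e \<subseteq> pot \<mu> -` (- {C})"
      using \<open>pot \<mu> x \<noteq> C\<close> by (metis ComplI open_contains_ball singletonD vimageI2)
    have "AE y in \<mu>. y \<notin> ball x e"
      using eq by eventually_elim (use e in auto)
    then have "emeasure \<mu> (ball x e) = 0"
      using prob_R_sets[OF \<mu>] by (subst (asm) AE_iff_measurable[OF _ refl]) (auto simp: sets_eq_imp_space_eq ball_def)
    then show False using that e by (auto simp: msupport_def)
  qed
  have "compact (msupport \<mu>)"
    using closed_msupport[OF prob_R_sets[OF \<mu>]] supp_K
    by (auto simp: compact_eq_bounded_closed bounded_real)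
  moreover have "V (x - y) \<le> 0" if "x \<in> msupport \<mu>" "y \<in> msupport \<mu>" for x y
    using msupport_V_nonpos[OF \<mu> K eq second supp_eq[OF that(1)] that(2)] .
  ultimately have "equilibrium p q \<mu> (msupport \<mu>) C"
    using ge supp_eq AE_msupport[OF prob_R_sets[OF \<mu>]] \<mu>
    by unfold_locales auto
  then show thesis by (rule that)
qed

section \<open>Classification for large exponents\<close>

lemma ennreal_half_plus_half: "inverse 2 + inverse 2 = (1 :: ennreal)"
proof -
  have "ennreal (1 / 2) + ennreal (1 / 2) = 1" by (subst ennreal_plus[symmetric]) simp_all
  then show ?thesis by simp
qed

text \<open>\<open>measure_of\<close> uses a set function only if it is countably additive;
  recognising it as the measure of a mixture settles this and opens the expansion rules for
  \<open>mix\<close>.\<close>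

lemma rho_star_eq_mix: "rho_star c = mix (1 / 2) (return borel c) (return borel (c + 1))"
  (is "_ = ?M")
proof -
  have MN: "prob_space (return borel c)" "prob_space (return borel (c + 1))"
    "sets (return borel (c + 1)) = sets (return borel c)"
    by (auto simp: prob_space_return)
  have em: "emeasure ?M A = ennreal ((indicator A c + indicator A (c + 1)) / 2)"
    if A: "A \<in> sets borel" for A
    using emeasure_mix[OF MN, of "1 / 2" A] A
    by (auto simp: indicator_def ennreal_half_plus_half)
  have sets: "sets ?M = sets borel" by (simp add: MN)
  have "rho_star c = measure_of UNIV (sets borel) (emeasure ?M)"
    unfolding rho_star_def
    by (rule measure_of_eq) (use em in \<open>auto simp: sets.sigma_sets_eq[of borel, simplified]\<close>)
  also have "\<dots> = measure_of (space ?M) (sets ?M) (emeasure ?M)"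
    using sets sets_eq_imp_space_eq[OF sets] by simp
  finally show ?thesis by (simp only: measure_of_of_measure)
qed

lemma prob_R_rho_star: "prob_R (rho_star c)"
  unfolding rho_star_eq_mix by (intro prob_R_mix prob_R_return) auto

lemma emeasure_rho_star:
  "A \<in> sets borel \<Longrightarrow> emeasure (rho_star c) A = ennreal ((indicator A c + indicator A (c + 1)) / 2)"
  unfolding rho_star_eq_mix
  by (subst emeasure_mix) (auto simp: prob_space_return indicator_def ennreal_half_plus_half)

text \<open>\<open>outer_p\<close> and \<open>inner_p\<close> say that the positive zero of
  \<open>V\<close> lies below 1 + \<delta> and its inflection point above 1 - \<delta>. Points of
  different clusters are at distance between 1 - 5 \<delta> (that is, 1 - \<delta> minus two cluster
  widths 2 \<delta>) and 1 + \<delta>, where \<open>inner\<close> and \<open>outer\<close> keep q-th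
  powers near 1. \<open>p_ge\<close> makes 11/(10 p) at most 1/(100 q).\<close>

locale large_exponent = interaction_potential +
  fixes \<delta> :: real
  assumes \<delta>: "0 < \<delta>" "\<delta> \<le> 1 / 20"
    and outer: "(1 + \<delta>) powr q \<le> 11 / 10" and inner: "9 / 10 \<le> (1 - 5 * \<delta>) powr q"
    and p_ge: "110 * q \<le> p"
    and outer_p: "p / q < (1 + \<delta>) powr (p - q)"
    and inner_p: "(p - 1) * (1 - \<delta>) powr (p - q) < q - 1"
begin

lemma V_nonpos_imp: 
  assumes "V u \<le> 0" 
  shows "\<bar>u\<bar> \<le> 1 + \<delta>"
proof (rule ccontr)
  assume "\<not> \<bar>u\<bar> \<le> 1 + \<delta>"
  then have u: "\<bar>u\<bar> > 1 + \<delta>" by simp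
  have "p / q < \<bar>u\<bar> powr (p - q)"
    using outer_p powr_mono2[of "p - q" "1 + \<delta>" "\<bar>u\<bar>"] u q_less_p \<delta> by simp
  then have "0 < \<bar>u\<bar> powr q * (\<bar>u\<bar> powr (p - q) / p - 1 / q)"
    using u \<delta> q_ge_2 q_less_p by (intro mult_pos_pos) (auto simp: field_simps)
  also have "\<dots> = V u" by (simp add: Vpot_def algebra_simps flip: powr_add)
  finally show False using assms by simp
qed

text \<open>Up to the positive factor |u|^(q-2), \<open>V''\<close> is increasing in |u| and still
  negative at 1 - \<delta>. The point 0 is excluded since \<open>V'' 0\<close> is 0 for q >
  2.\<close>

lemma V''_neg:
  assumes "u \<noteq> 0" "\<bar>u\<bar> < 1 - \<delta>"
  shows "V'' u < 0"
proof -
  have "\<bar>u\<bar> powr (p - q) \<le> (1 - \<delta>) powr (p - q)"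
    using assms q_less_p by (intro powr_mono2) auto
  then have "(p - 1) * \<bar>u\<bar> powr (p - q) \<le> (p - 1) * (1 - \<delta>) powr (p - q)"
    using q_ge_2 q_less_p by (intro mult_left_mono) auto
  with inner_p have "(p - 1) * \<bar>u\<bar> powr (p - q) - (q - 1) < 0" by simp
  then have "\<bar>u\<bar> powr (q - 2) * ((p - 1) * \<bar>u\<bar> powr (p - q) - (q - 1)) < 0"
    using assms by (intro mult_pos_neg) auto
  also have "\<bar>u\<bar> powr (q - 2) * ((p - 1) * \<bar>u\<bar> powr (p - q) - (q - 1)) = V'' u"
    using assms q_ge_2 q_less_p by (auto simp: V''_def apow_def algebra_simps simp flip: powr_add)
  finally show ?thesis .
qed

lemma V''_0: "V'' 0 \<le> 0"
  using q_ge_2 q_less_p by (auto simp: V''_def apow_def)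

end

section \<open>Geometry of the support: two clusters, their masses, and collapse to two
  points\<close>

locale large_equilibrium = equilibrium + large_exponent
begin

sublocale prob_space \<mu> by (rule prob_R_space) (rule prob_R)

lemma sets_\<mu> [measurable_cong, simp]: "sets \<mu> = sets borel"
  using prob_R by (rule prob_R_sets)

definition a :: real where "a = Inf S"
definition b :: real where "b = Sup S"

lemma S_nonempty: "S \<noteq> {}"
  using AE_S AE_False by auto

lemma a_in: "a \<in> S" and a_le: "x \<in> S \<Longrightarrow> a \<le> x"
  unfolding a_def using compact_S S_nonempty
  by (auto intro!: closed_contains_Inf cInf_lower bounded_imp_bdd_below
      dest: compact_imp_closed compact_imp_bounded)

lemma b_in: "b \<in> S" and b_ge: "x \<in> S \<Longrightarrow> x \<le> b"
  unfolding b_def using compact_S S_nonempty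
  by (auto intro!: closed_contains_Sup cSup_upper bounded_imp_bdd_above
      dest: compact_imp_closed compact_imp_bounded)

lemma bounded_\<mu>: "AE x in \<mu>. \<bar>x\<bar> \<le> max \<bar>a\<bar> \<bar>b\<bar>"
  using AE_S by eventually_elim (use a_le b_ge in force)

lemmas integrable_cont = integrable_bounded_support[OF prob_R bounded_\<mu>]

lemma integrable_V: "integrable \<mu> (\<lambda>y. V (z - y))"
  and integrable_V': "integrable \<mu> (\<lambda>y. V' (z - y))"
  and integrable_V'': "integrable \<mu> (\<lambda>y. V'' (z - y))"
  by (auto intro!: integrable_cont continuous_intros continuous_on_compose2[OF continuous_on_V]
      continuous_on_compose2[OF continuous_on_V'] continuous_on_compose2[OF continuous_on_V''])

lemmas pot_deriv = DERIV_pot[OF prob_R bounded_\<mu>]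
lemmas pot_deriv' = DERIV_pot'[OF prob_R bounded_\<mu>]

lemma stationary:
  assumes "x \<in> S"
  shows "(\<integral>y. V' (x - y) \<partial>\<mu>) = 0" "(\<integral>y. V'' (x - y) \<partial>\<mu>) \<ge> 0"
  using local_min_second_derivative[OF pot_deriv pot_deriv', of 1 x] pot_ge pot_eq[OF assms]
  by auto

text \<open>If all of S were closer, \<open>V'' (x - y)\<close> would be nonpositive on S while its
  integral is nonnegative; it would then vanish almost everywhere, making \<mu> the Dirac mass at x.
  That is no equilibrium: its potential is lower at x + 1.\<close>

lemma far_point:
  assumes x: "x \<in> S"
  shows "\<exists>y\<in>S. 1 - \<delta> \<le> \<bar>x - y\<bar>"
proof (rule ccontr)
  assume "\<not> ?thesis"
  then have near: "\<bar>x - y\<bar> < 1 - \<delta>" if "y \<in> S" for y using that not_le by blast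
  have nonpos: "AE y in \<mu>. V'' (x - y) \<le> 0"
    using AE_S
  proof eventually_elim
    case (elim y)
    then show ?case using V''_neg[of "x - y"] near[of y] V''_0 by (cases "x = y") auto
  qed
  have "(\<integral>y. - V'' (x - y) \<partial>\<mu>) = 0"
    using stationary(2)[OF x] integral_nonneg_AE[of "\<lambda>y. - V'' (x - y)" \<mu>] nonpos by simp
  then have "AE y in \<mu>. - V'' (x - y) = 0"
    using nonpos integrable_V'' by (subst (asm) integral_nonneg_eq_0_iff_AE) auto
  then have eq: "AE y in \<mu>. y = x"
    using AE_S
  proof eventually_elim
    case (elim y)
    then show ?case using V''_neg[of "x - y"] near[of y] by force
  qed
  have pot: "pot \<mu> z = V (z - x)" for z
  proof -
    have "pot \<mu> z = (\<integral>y. V (z - x) \<partial>\<mu>)"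
      unfolding pot_def by (rule integral_cong_AE) (use eq in auto)
    then show ?thesis by (simp add: prob_space)
  qed
  show False using pot_ge[of "x + 1"] pot_eq[OF x] V_1 by (simp add: pot)
qed

lemma diam: "b - a \<le> 1 + \<delta>" "1 - \<delta> \<le> b - a"
proof -
  show "b - a \<le> 1 + \<delta>" using V_nonpos_imp[OF V_le[OF b_in a_in]] by simp
  obtain y where "y \<in> S" "\<bar>a - y\<bar> \<ge> 1 - \<delta>" using far_point[OF a_in] by blast
  then show "1 - \<delta> \<le> b - a" using a_le[of y] b_ge[of y] by simp
qed

text \<open>Two points at distance at least 1 - \<delta> in an interval of length at most 1 +
  \<delta> leave a slack of 2 \<delta> to its ends.\<close>

lemma clusters:
  assumes "x \<in> S"
  shows "x \<le> a + 2 * \<delta> \<or> b - 2 * \<delta> \<le> x"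
proof -
  obtain y where "y \<in> S" "\<bar>x - y\<bar> \<ge> 1 - \<delta>" using far_point[OF assms] by blast
  then show ?thesis using a_le[of y] b_ge[of y] diam by linarith
qed

lemma cluster_gap: "a + 2 * \<delta> < b - 2 * \<delta>"
  using diam \<delta> by linarith

definition m :: real where "m = prob {..a + 2 * \<delta>}"
definition n :: real where "n = prob {b - 2 * \<delta>..}"

lemma m_plus_n: "m + n = 1"
proof -
  have "m + n = prob ({..a + 2 * \<delta>} \<union> {b - 2 * \<delta>..})"
    unfolding m_def n_def using cluster_gap by (intro finite_measure_Union[symmetric]) auto
  also have "\<dots> = 1"
    using AE_S by (subst prob_eq_1) (auto elim!: eventually_mono dest: clusters)
  finally show ?thesis .
qed

text \<open>The estimates below have this form: one constant per cluster, weighted with the cluster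
  masses m and n.\<close>

lemma integral_ge_clusters:
  assumes "integrable \<mu> f"
    and "\<And>y. y \<in> S \<Longrightarrow> y \<le> a + 2 * \<delta> \<Longrightarrow> c \<le> f y"
    and "\<And>y. y \<in> S \<Longrightarrow> b - 2 * \<delta> \<le> y \<Longrightarrow> d \<le> f y"
  shows "c * m + d * n \<le> (\<integral>y. f y \<partial>\<mu>)"
proof -
  have int: "integrable \<mu> (\<lambda>y. c * indicator {..a + 2 * \<delta>} y + d * indicator {b - 2 * \<delta>..} y)"
    by (intro Bochner_Integration.integrable_add integrable_mult_right integrable_real_indicator)
      (auto simp: emeasure_eq_measure)
  have "c * m + d * n = (\<integral>y. c * indicator {..a + 2 * \<delta>} y + d * indicator {b - 2 * \<delta>..} y \<partial>\<mu>)"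
    by (subst Bochner_Integration.integral_add) (auto simp: m_def n_def emeasure_eq_measure)
  also have "\<dots> \<le> (\<integral>y. f y \<partial>\<mu>)"
  proof (rule integral_mono_AE[OF int assms(1)])
    show "AE y in \<mu>. c * indicator {..a + 2 * \<delta>} y + d * indicator {b - 2 * \<delta>..} y \<le> f y"
      using AE_S
    proof eventually_elim
      case (elim y)
      then show ?case
        using clusters[OF elim] cluster_gap assms(2,3)[OF elim] by (auto simp: indicator_def)
    qed
  qed
  finally show ?thesis .
qed

lemma R_powr: "0 \<le> t \<Longrightarrow> t \<le> 1 + \<delta> \<Longrightarrow> 0 \<le> s \<Longrightarrow> s \<le> q \<Longrightarrow> t powr s \<le> 11 / 10"
proof -
  assume "0 \<le> t" "t \<le> 1 + \<delta>" "0 \<le> s" "s \<le> q"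
  then have "t powr s \<le> (1 + \<delta>) powr s" by (intro powr_mono2) auto
  also have "\<dots> \<le> (1 + \<delta>) powr q" using \<open>s \<le> q\<close> \<delta> by (intro powr_mono) auto
  finally show ?thesis using outer by simp
qed

lemma powr_ge_inner: "1 - 5 * \<delta> \<le> t \<Longrightarrow> 0 \<le> s \<Longrightarrow> s \<le> q \<Longrightarrow> 9 / 10 \<le> t powr s"
proof -
  assume t: "1 - 5 * \<delta> \<le> t" and s: "0 \<le> s" "s \<le> q"
  have "9 / 10 \<le> (1 - 5 * \<delta>) powr q" by (rule inner)
  also have "\<dots> \<le> (1 - 5 * \<delta>) powr s" using s \<delta> by (intro powr_mono') auto
  also have "\<dots> \<le> t powr s" using t s \<delta> by (intro powr_mono2) auto
  finally show ?thesis .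
qed

lemma powr_small: "0 \<le> t \<Longrightarrow> t \<le> 2 * \<delta> \<Longrightarrow> 1 \<le> s \<Longrightarrow> t powr s \<le> 1 / 10"
proof -
  assume t: "0 \<le> t" "t \<le> 2 * \<delta>" and s: "1 \<le> s"
  have "t powr s \<le> t powr 1" using t s \<delta> by (intro powr_mono') auto
  then show ?thesis using t \<delta> by simp
qed

text \<open>The potential takes the same value C at both ends. Seen from b, the far cluster of mass
  m pushes C down to about -m/q; seen from a, C cannot be much below -n/q. So n cannot be much
  smaller than m: with the constants at hand, 0.79 \<le> 1.9 n.\<close>

lemma n_ge: "2 / 5 \<le> n"
proof -
  define R where "R = 1 + \<delta>"
  have q0: "q > 0" "p > 0" using q_ge_2 q_less_p by auto
  text \<open>The derivative of the potential vanishes at b; adding a multiple of it makes the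
    contribution of the exponent p have a sign.\<close>
  have "(9 / 10 / q - 11 / 10 / p) * m + (- (11 / 10 / p)) * n
      \<le> (\<integral>y. R / p * V' (b - y) - V (b - y) \<partial>\<mu>)"
  proof (rule integral_ge_clusters)
    \<comment> \<open>For t \<le> R the p-term R/p t^(p-1) - t^p/p is nonnegative; the remaining
      loss is at most R^q / p \<le> 11/(10 p).\<close>
    have key: "t powr q / q - 11 / 10 / p \<le> R / p * V' t - V t" if t: "0 \<le> t" "t \<le> R" for t
    proof -
      have "t powr p = t * t powr (p - 1)" using t q_ge_2 q_less_p
        by (cases "t = 0") (auto simp: powr_diff)
      then have 1: "t powr p / p \<le> R / p * t powr (p - 1)"
        using t q0 by (simp add: divide_right_mono mult_right_mono)
      have "R * t powr (q - 1) \<le> R * R powr (q - 1)"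
        using t q_ge_2 by (intro mult_left_mono powr_mono2) auto
      also have "\<dots> = R powr q" using \<delta> by (simp add: R_def powr_diff)
      finally have "R * t powr (q - 1) \<le> 11 / 10" using outer by (simp add: R_def)
      then have 2: "R / p * t powr (q - 1) \<le> 11 / 10 / p"
        using q0 divide_right_mono[of "R * t powr (q - 1)" "11 / 10" p] by simp
      have "R / p * V' t = R / p * t powr (p - 1) - R / p * t powr (q - 1)"
        using t q_ge_2 q_less_p by (cases "t = 0") (auto simp: V'_def spow_def algebra_simps)
      then show ?thesis using 1 2 t by (simp add: Vpot_def)
    qed
    have range: "0 \<le> b - y" "b - y \<le> R" if "y \<in> S" for y
      using b_ge[OF that] a_le[OF that] diam by (auto simp: R_def)
    show "9 / 10 / q - 11 / 10 / p \<le> R / p * V' (b - y) - V (b - y)"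
      if "y \<in> S" "y \<le> a + 2 * \<delta>" for y
    proof -
      have "9 / 10 \<le> (b - y) powr q"
        using that diam \<delta> q_ge_2 by (intro powr_ge_inner) auto
      then have "9 / 10 / q \<le> (b - y) powr q / q" using q0 by (intro divide_right_mono) auto
      then show ?thesis using key[OF range[OF that(1)]] by simp
    qed
    show "- (11 / 10 / p) \<le> R / p * V' (b - y) - V (b - y)" if "y \<in> S" for y
    proof -
      have "0 \<le> (b - y) powr q / q" using q0 by simp
      then show ?thesis using key[OF range[OF that(1)]] by linarith
    qed
  qed (use integrable_V integrable_V' in auto)
  also have "\<dots> = - C"
    using integrable_V integrable_V' stationary(1)[OF b_in] pot_eq[OF b_in] by (simp add: pot_def)
  finally have upper: "(9 / 10 / q - 11 / 10 / p) * m - 11 / 10 / p * n \<le> - C" by simp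
  have "- (1 / 10 / q) * m + (- (11 / 10 / q)) * n \<le> (\<integral>y. V (a - y) \<partial>\<mu>)"
  proof (rule integral_ge_clusters)
    have key: "- (\<bar>u\<bar> powr q / q) \<le> V u" for u using q0 by (simp add: Vpot_def)
    show "- (1 / 10 / q) \<le> V (a - y)" if "y \<in> S" "y \<le> a + 2 * \<delta>" for y
    proof -
      have "\<bar>a - y\<bar> powr q \<le> 1 / 10"
        using that a_le[of y] q_ge_2 by (intro powr_small) auto
      then have "\<bar>a - y\<bar> powr q / q \<le> 1 / 10 / q" using q0 by (intro divide_right_mono) auto
      then show ?thesis using key[of "a - y"] by linarith
    qed
    show "- (11 / 10 / q) \<le> V (a - y)" if "y \<in> S" for y
    proof -
      have "\<bar>a - y\<bar> powr q \<le> 11 / 10"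
        using that a_le[of y] b_ge[of y] diam q_ge_2 by (intro R_powr) auto
      then have "\<bar>a - y\<bar> powr q / q \<le> 11 / 10 / q" using q0 by (intro divide_right_mono) auto
      then show ?thesis using key[of "a - y"] by linarith
    qed
  qed (use integrable_V in auto)
  also have "\<dots> = C" using pot_eq[OF a_in] by (simp add: pot_def)
  finally have lower: "- (1 / 10 / q) * m - 11 / 10 / q * n \<le> C" by simp
  have "11 / 10 / p \<le> 11 / 10 / (110 * q)" using p_ge q0 by (intro divide_left_mono) auto
  then have "11 / 10 / p * (m + n) \<le> 1 / 100 / q" by (simp add: m_plus_n)
  moreover have "(9 / 10 / q - 11 / 10 / p) * m - 11 / 10 / p * n
      = 9 / 10 / q * m - 11 / 10 / p * (m + n)"
    by (simp add: algebra_simps add_divide_distrib)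
  ultimately have "9 / 10 / q * m - 1 / 100 / q \<le> 1 / 10 / q * m + 11 / 10 / q * n"
    using upper lower by linarith
  then have "(9 / 10 * m - 1 / 100) / q \<le> (1 / 10 * m + 11 / 10 * n) / q"
    by (simp add: add_divide_distrib diff_divide_distrib)
  then have "9 / 10 * m - 1 / 100 \<le> 1 / 10 * m + 11 / 10 * n"
    using q0 by (subst (asm) divide_le_cancel) auto
  then show ?thesis using m_plus_n by linarith
qed

text \<open>Criticality is assumed rather than z \<in> S, because the lemma is applied to a maximum
  of the potential between two support points.\<close>

lemma left_cluster_convex:
  assumes z: "a \<le> z" "z \<le> a + 2 * \<delta>" and crit: "(\<integral>y. V' (z - y) \<partial>\<mu>) = 0"
  shows "0 < (\<integral>y. V'' (z - y) \<partial>\<mu>)"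
proof -
  define k where "k = (p - 1) / (1 + \<delta>)"
  have q0: "q - 1 > 0" "p - 1 > 0" using q_ge_2 q_less_p by auto
  text \<open>The first derivative vanishes, so k times it is added for free; k is chosen such that
    on the far cluster the exponent p then contributes with a sign.\<close>
  have "(- (q - 1) - k / 10) * m + (9 / 10 * k - 11 / 10 * (q - 1)) * n
      \<le> (\<integral>y. V'' (z - y) + k * V' (z - y) \<partial>\<mu>)"
  proof (rule integral_ge_clusters)
    have k0: "k \<ge> 0" using q0 \<delta> by (simp add: k_def)
    show "- (q - 1) - k / 10 \<le> V'' (z - y) + k * V' (z - y)" if "y \<in> S" "y \<le> a + 2 * \<delta>" for y
    proof -
      define t where "t = \<bar>z - y\<bar>"
      have t: "0 \<le> t" "t \<le> 2 * \<delta>" using that z a_le[of y] by (auto simp: t_def)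
      have t1: "t powr (q - 1) \<le> 1 / 10" by (rule powr_small) (use t q_ge_2 in auto)
      have t2: "t powr (q - 2) \<le> 1"
        using t q_ge_2 \<delta> powr_mono2[of "q - 2" t 1] by auto
      have "t powr (p - 1) \<le> t powr (q - 1)"
        using t q_ge_2 q_less_p \<delta> by (intro powr_mono') auto
      then have "\<bar>V' (z - y)\<bar> \<le> 1 / 10"
        using t1 powr_ge_zero[of t "p - 1"]
        by (auto simp: V'_def spow_def sgn_if t_def[symmetric] abs_le_iff simp del: powr_ge_zero)
      then have "\<bar>k * V' (z - y)\<bar> \<le> k / 10"
        using k0 mult_left_mono[of "\<bar>V' (z - y)\<bar>" "1 / 10" k] by (simp add: abs_mult)
      moreover have "- (q - 1) \<le> V'' (z - y)"
      proof -
        have "0 \<le> (p - 1) * apow (p - 2) (z - y)" using q0 by (simp add: apow_def)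
        moreover have "(q - 1) * apow (q - 2) (z - y) \<le> (q - 1) * 1"
          using q0 t2 by (intro mult_left_mono) (auto simp: apow_def t_def)
        ultimately show ?thesis by (simp add: V''_def)
      qed
      ultimately show ?thesis by linarith
    qed
    show "9 / 10 * k - 11 / 10 * (q - 1) \<le> V'' (z - y) + k * V' (z - y)"
      if "y \<in> S" "b - 2 * \<delta> \<le> y" for y
    proof -
      define t where "t = y - z"
      have t: "1 - 5 * \<delta> \<le> t" "t \<le> 1 + \<delta>" "t > 0"
        using that z diam b_ge[of y] \<delta> by (auto simp: t_def)
      have abs_t: "\<bar>z - y\<bar> = t" "sgn (z - y) = - 1" "z \<noteq> y" using t by (auto simp: t_def)
      have "t powr (p - 1) = t * t powr (p - 2)"
        using t powr_add[of t 1 "p - 2"] by simp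
      then have "k * t powr (p - 1) = (p - 1) * t powr (p - 2) * (t / (1 + \<delta>))"
        by (simp add: k_def)
      also have "\<dots> \<le> (p - 1) * t powr (p - 2) * 1"
        using t q0 by (intro mult_left_mono) auto
      finally have 1: "k * t powr (p - 1) \<le> (p - 1) * t powr (p - 2)" by simp
      have 2: "k * (9 / 10) \<le> k * t powr (q - 1)"
        using k0 t q_ge_2 by (intro mult_left_mono powr_ge_inner) auto
      have 3: "(q - 1) * t powr (q - 2) \<le> (q - 1) * (11 / 10)"
        using q0 t q_ge_2 by (intro mult_left_mono R_powr) auto
      have "V'' (z - y) + k * V' (z - y) = (p - 1) * t powr (p - 2) - (q - 1) * t powr (q - 2)
          - k * t powr (p - 1) + k * t powr (q - 1)"
        using t abs_t by (simp add: V''_def V'_def spow_def apow_def algebra_simps)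
      then show ?thesis using 1 2 3 by linarith
    qed
  qed (use integrable_V' integrable_V'' in auto)
  also have "\<dots> = (\<integral>y. V'' (z - y) \<partial>\<mu>)"
    using integrable_V' integrable_V'' crit by simp
  finally have lower: "(- (q - 1) - k / 10) * m + (9 / 10 * k - 11 / 10 * (q - 1)) * n
      \<le> (\<integral>y. V'' (z - y) \<partial>\<mu>)" .
  \<comment> \<open>\<delta> \<le> 1/20 gives the factor 20/21, and p \<ge> 110 q then yields k
    \<ge> 20/21 * 110 (q - 1) > 100 (q - 1).\<close>
  have "20 / 21 * (p - 1) \<le> k"
  proof -
    have "20 / 21 * (p - 1) * (1 + \<delta>) \<le> 20 / 21 * (p - 1) * (21 / 20)"
      using \<delta> q0 by (intro mult_left_mono) auto
    also have "\<dots> = p - 1" by (simp add: field_simps)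
    finally show ?thesis using \<delta> unfolding k_def by (subst pos_le_divide_eq) auto
  qed
  moreover have "110 * (q - 1) \<le> p - 1" using p_ge by simp
  ultimately have k: "100 * (q - 1) \<le> k"
    using q0 mult_left_mono[of "110 * (q - 1)" "p - 1" "20 / 21"] by (simp add: field_simps)
  have "2 / 5 * (k - (q - 1) / 10) \<le> n * (k - (q - 1) / 10)"
    using n_ge k q0 by (intro mult_right_mono) auto
  moreover have "(- (q - 1) - k / 10) * m + (9 / 10 * k - 11 / 10 * (q - 1)) * n
      = n * (k - (q - 1) / 10) - (q - 1) - k / 10"
  proof -
    have m: "m = 1 - n" using m_plus_n by simp
    show ?thesis unfolding m by (simp add: field_simps)
  qed
  \<comment> \<open>The right side equals 0.3 k - 1.04 (q - 1), positive by k \<ge> 100 (q -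
    1).\<close>
  moreover have "0 < 2 / 5 * (k - (q - 1) / 10) - (q - 1) - k / 10"
    using k q0 by (simp add: field_simps)
  ultimately show ?thesis using lower by linarith
qed

lemma left_cluster_singleton:
  assumes x: "x \<in> S" "x \<le> a + 2 * \<delta>"
  shows "x = a"
proof (rule ccontr)
  assume "x \<noteq> a"
  then have "a < x" using a_le[OF x(1)] by simp
  obtain w where w: "a \<le> w" "w \<le> x" "\<And>v. a \<le> v \<Longrightarrow> v \<le> x \<Longrightarrow> pot \<mu> v \<le> pot \<mu> w"
    using continuous_attains_sup[of "{a..x}" "pot \<mu>"] \<open>a < x\<close>
      continuous_on_pot[OF prob_R bounded_\<mu>] by auto
  obtain z where z: "a < z" "z < x" "\<And>v. a \<le> v \<Longrightarrow> v \<le> x \<Longrightarrow> pot \<mu> v \<le> pot \<mu> z"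
  proof (cases "w = a \<or> w = x")
    case True
    \<comment> \<open>A maximum at an end point has the globally minimal value C; the potential is
      then constant from a to x and the midpoint is an interior maximum.\<close>
    then have "pot \<mu> w = C" using a_in x pot_eq by auto
    then show thesis
      using \<open>a < x\<close> w(3) pot_ge[of "(a + x) / 2"] by (intro that[of "(a + x) / 2"]) force+
  next
    case False
    then show thesis using w by (intro that[of w]) auto
  qed
  define d where "d = min (z - a) (x - z)"
  have "d > 0" using z by (simp add: d_def)
  have max: "pot \<mu> v \<le> pot \<mu> z" if "\<bar>v - z\<bar> < d" for v
    using that by (intro z(3)) (auto simp: d_def)
  show False
    using local_max_second_derivative[OF pot_deriv pot_deriv' \<open>d > 0\<close> max]
      left_cluster_convex[of z] z x(2) by force
qed

text \<open>\<open>V\<close> is even, so reflection swaps the clusters: what is proved for the left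
  cluster, including the mass bound behind it, applies to the right one.\<close>

lemma reflected: "large_equilibrium p q (distr \<mu> borel uminus) (uminus ` S) C \<delta>"
proof -
  have [measurable]: "S \<in> sets borel" using compact_S by (simp add: compact_imp_closed)
  have [simp]: "pot (distr \<mu> borel uminus) z = pot \<mu> (- z)" for z
  proof -
    have "pot (distr \<mu> borel uminus) z = (\<integral>y. V (z - - y) \<partial>\<mu>)"
      unfolding pot_def by (rule integral_distr) measurable
    also have "\<dots> = (\<integral>y. V (- (- z - y)) \<partial>\<mu>)" by (simp add: add.commute)
    finally show ?thesis by (simp only: V_minus pot_def)
  qed
  show ?thesis
  proof
    show "prob_R (distr \<mu> borel uminus)" by (rule prob_R_distr[OF prob_R]) measurable
    show "compact (uminus ` S)" by (rule compact_negations[OF compact_S])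
    then have [measurable]: "uminus ` S \<in> sets borel" by (simp add: compact_imp_closed)
    show "AE x in distr \<mu> borel uminus. x \<in> uminus ` S"
      by (subst AE_distr_iff) (use AE_S in \<open>auto elim!: eventually_mono\<close>)
    show "V (x - y) \<le> 0" if "x \<in> uminus ` S" "y \<in> uminus ` S" for x y
      using that V_le V_commute by force
  qed (use pot_ge pot_eq in auto)
qed

lemma b_minus_reflected: "large_equilibrium.a (uminus ` S) = - b"
proof -
  interpret r: large_equilibrium p q "distr \<mu> borel uminus" "uminus ` S" C \<delta> by (rule reflected)
  show ?thesis
    using r.a_in r.a_le[of "- b"] b_in b_ge by force
qed

lemma S_points:
  assumes "x \<in> S"
  shows "x = a \<or> x = b"
proof -
  interpret r: large_equilibrium p q "distr \<mu> borel uminus" "uminus ` S" C \<delta> by (rule reflected)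
  show ?thesis
    using clusters[OF assms] left_cluster_singleton[OF assms] r.left_cluster_singleton[of "- x"] assms
    by (auto simp: b_minus_reflected)
qed

lemma integral_two_points:
  fixes f :: "real \<Rightarrow> real"
  assumes [measurable]: "f \<in> borel_measurable borel"
  shows "(\<integral>y. f y \<partial>\<mu>) = f a * prob {a} + f b * prob {b}"
proof -
  have "a \<noteq> b" using diam \<delta> by auto
  have "(\<integral>y. f y \<partial>\<mu>) = (\<integral>y. f a * indicator {a} y + f b * indicator {b} y \<partial>\<mu>)"
    by (rule integral_cong_AE)
      (use AE_S \<open>a \<noteq> b\<close> in \<open>auto elim!: eventually_mono dest!: S_points\<close>)
  also have "\<dots> = f a * prob {a} + f b * prob {b}"
    by (subst Bochner_Integration.integral_add) (auto simp: emeasure_eq_measure)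
  finally show ?thesis .
qed

lemma eq_rho_star: "\<mu> = rho_star a"
proof -
  have ab: "a < b" using diam \<delta> by auto
  have "n = prob {b}"
    unfolding n_def
    by (rule finite_measure_eq_AE) (use AE_S cluster_gap \<delta> in \<open>auto elim!: eventually_mono dest!: S_points\<close>)
  then have nb: "prob {b} > 0" using n_ge by simp
  \<comment> \<open>The mass at a exerts no force on itself, so stationarity at a concerns b
    alone.\<close>
  have "V' (a - b) * prob {b} = 0"
    using stationary(1)[OF a_in] integral_two_points[of "\<lambda>y. V' (a - y)"]
    by (simp add: V'_def spow_def)
  then have "V' (b - a) = 0" using nb V'_minus[of "a - b"] by simp
  then have "(b - a) powr (p - 1) = (b - a) powr (q - 1)" using ab by (simp add: V'_def spow_def)
  then have "b - a = 1" using ab q_less_p powr_inj[of "b - a" "p - 1" "q - 1"] by auto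
  then have b: "b = a + 1" by simp
  \<comment> \<open>As V 0 = 0, each point feels only the mass at the other; equality of the two
    potentials then balances the masses.\<close>
  have "V (- 1) * prob {b} = C" "V 1 * prob {a} = C"
    using pot_eq[OF a_in] pot_eq[OF b_in] integral_two_points[of "\<lambda>y. V (a - y)"]
      integral_two_points[of "\<lambda>y. V (b - y)"] by (simp_all add: pot_def b)
  then have "V 1 * prob {a} = V 1 * prob {b}" by simp
  then have "prob {a} = prob {b}" using V_1 by (subst (asm) mult_left_cancel) auto
  moreover have "prob {a} + prob {b} = 1" using integral_two_points[of "\<lambda>_. 1"] by (simp add: prob_space)
  ultimately have half: "prob {a} = 1 / 2" "prob {b} = 1 / 2" by auto
  show ?thesis
  proof (rule measure_eqI)
    show "sets \<mu> = sets (rho_star a)" using prob_R_sets[OF prob_R_rho_star] by simp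
    fix A assume "A \<in> sets \<mu>"
    then have A: "A \<in> sets borel" by simp
    have "prob A = (\<integral>y. indicator A y \<partial>\<mu>)" using A by simp
    also have "\<dots> = (indicator A a + indicator A (a + 1)) / 2"
      using integral_two_points[of "indicator A"] A half by (simp add: b)
    finally show "emeasure \<mu> A = emeasure (rho_star a) A"
      using A by (simp add: emeasure_eq_measure emeasure_rho_star)
  qed
qed

end

lemma (in large_exponent) directional_min_eq_rho_star:
  assumes "directional_min \<mu>"
  obtains c where "\<mu> = rho_star c"
proof -
  obtain S C where "equilibrium p q \<mu> S C" using directional_min_equilibrium[OF assms] .
  then interpret large_equilibrium p q \<mu> S C \<delta>
    by (simp add: large_equilibrium_def large_exponent_axioms)
  show thesis by (rule that) (rule eq_rho_star)
qed

section \<open>Existence of global minimizers\<close>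

text \<open>Markov's inequality, with k so large that M / k < \<epsilon>.\<close>

lemma tight_of_bounded_first_moment:
  assumes \<mu>: "\<And>n. prob_R (\<mu> n)" and M: "\<And>n. (\<integral>\<^sup>+y. ennreal \<bar>y\<bar> \<partial>\<mu> n) \<le> ennreal M" "0 \<le> M"
  shows "tight \<mu>"
  unfolding tight_def
proof (intro conjI allI impI)
  show rd: "real_distribution (\<mu> n)" for n
    using \<mu>[of n] by (auto simp: prob_R_def real_distribution_def real_distribution_axioms_def)
  fix \<epsilon> :: real assume \<epsilon>: "\<epsilon> > 0"
  define k where "k = (M + 1) / \<epsilon>"
  have k: "k > 0" "M / k < \<epsilon>" using \<epsilon> M by (auto simp: k_def field_simps)
  have "1 - \<epsilon> < measure (\<mu> n) {- k<..k}" for n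
  proof -
    interpret real_distribution "\<mu> n" by (rule rd)
    have "emeasure (\<mu> n) {y \<in> UNIV. 1 \<le> ennreal (1 / k) * ennreal \<bar>y\<bar>}
        \<le> ennreal (1 / k) * (\<integral>\<^sup>+y. ennreal \<bar>y\<bar> * indicator UNIV y \<partial>\<mu> n)"
      by (rule nn_integral_Markov_inequality) auto
    also have "{y \<in> UNIV. 1 \<le> ennreal (1 / k) * ennreal \<bar>y\<bar>} = {y. k \<le> \<bar>y\<bar>}"
      using k by (auto simp: ennreal_mult[symmetric] field_simps simp del: ennreal_1 simp flip: ennreal_1)
    also have "ennreal (1 / k) * (\<integral>\<^sup>+y. ennreal \<bar>y\<bar> * indicator UNIV y \<partial>\<mu> n) \<le> ennreal (1 / k) * ennreal M"
      using M(1)[of n] by (intro mult_left_mono) auto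
    also have "\<dots> = ennreal (M / k)" using k M by (simp flip: ennreal_mult)
    finally have "prob {y. k \<le> \<bar>y\<bar>} \<le> M / k"
      using k M by (simp add: emeasure_eq_measure ennreal_le_iff)
    moreover have "prob (- {y. k \<le> \<bar>y\<bar>}) = 1 - prob {y. k \<le> \<bar>y\<bar>}"
    proof -
      have [measurable]: "{y::real. k \<le> \<bar>y\<bar>} \<in> sets borel" by measurable
      show ?thesis using prob_compl[of "{y. k \<le> \<bar>y\<bar>}"] by (simp add: Compl_eq_Diff_UNIV)
    qed
    moreover have "prob (- {y. k \<le> \<bar>y\<bar>}) \<le> prob {- k<..k}"
      by (rule finite_measure_mono) auto
    ultimately show ?thesis using k by linarith
  qed
  then show "\<exists>a b. a < b \<and> (\<forall>n. 1 - \<epsilon> < measure (\<mu> n) {a<..b})"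
    using k by (intro exI[of _ "- k"] exI[of _ k]) auto
qed

context interaction_potential
begin

lemma cross_distr:
  assumes "sets M = sets borel" "prob_space M" and f: "f \<in> M \<rightarrow>\<^sub>M borel"
  shows "cross (distr M borel f) (distr M borel f) = (\<integral>\<^sup>+x. \<integral>\<^sup>+y. ennreal (W (f x - f y)) \<partial>M \<partial>M)"
proof -
  interpret prob_space M by fact
  note [measurable] = f
  have "prob_R (distr M borel f)" by (auto simp: prob_R_def prob_space_distr f)
  from measurable_potential[OF this] show ?thesis
    unfolding cross_def by (subst nn_integral_distr) (auto simp: nn_integral_distr)
qed

text \<open>Lower semicontinuity of the energy: on Skorohod's common probability space the kernel
  converges pointwise, and Fatou's lemma is applied once in each variable.\<close>

lemma cross_weak_limit:
  assumes \<mu>: "\<And>n. prob_R (\<mu> n)" and M: "real_distribution M" and lim: "weak_conv_m \<mu> M"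
  shows "cross M M \<le> liminf (\<lambda>n. cross (\<mu> n) (\<mu> n))"
proof -
  have rd: "real_distribution (\<mu> n)" for n
    using \<mu>[of n] by (auto simp: prob_R_def real_distribution_def real_distribution_axioms_def)
  obtain \<Omega> :: "real measure" and Y Z where \<Omega>: "prob_space \<Omega>"
    and Y: "\<And>n. Y n \<in> \<Omega> \<rightarrow>\<^sub>M borel" "\<And>n. distr \<Omega> borel (Y n) = \<mu> n"
    and Z: "Z \<in> \<Omega> \<rightarrow>\<^sub>M lborel" "distr \<Omega> borel Z = M"
    and conv: "\<And>x. x \<in> space \<Omega> \<Longrightarrow> (\<lambda>n. Y n x) \<longlonglongrightarrow> Z x"
    using Skorohod[OF rd M lim] by blast
  interpret prob_space \<Omega> by fact
  have [measurable]: "Z \<in> \<Omega> \<rightarrow>\<^sub>M borel" using Z(1) by simp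
  note [measurable] = Y(1)
  have cross_eq: "cross (distr \<Omega> borel f) (distr \<Omega> borel f) = (\<integral>\<^sup>+x. \<integral>\<^sup>+y. ennreal (W (f x - f y)) \<partial>\<Omega> \<partial>\<Omega>)"
    if [measurable]: "f \<in> \<Omega> \<rightarrow>\<^sub>M borel" for f
  proof -
    have "prob_R (distr \<Omega> borel f)" by (auto simp: prob_R_def prob_space_distr)
    from measurable_potential[OF this] show ?thesis
      unfolding cross_def by (subst nn_integral_distr) (auto simp: nn_integral_distr)
  qed
  have lim_W: "liminf (\<lambda>n. ennreal (W (Y n x - Y n y))) = ennreal (W (Z x - Z y))"
    if "x \<in> space \<Omega>" "y \<in> space \<Omega>" for x y
  proof -
    have "isCont W (Z x - Z y)"
      unfolding W_def using DERIV_isCont[OF DERIV_V] by (intro continuous_intros) auto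
    then have "(\<lambda>n. ennreal (W (Y n x - Y n y))) \<longlonglongrightarrow> ennreal (W (Z x - Z y))"
      by (intro tendsto_ennrealI isCont_tendsto_compose[where g = W] tendsto_diff conv that)
    then show ?thesis by (intro lim_imp_Liminf) auto
  qed
  have "cross M M = (\<integral>\<^sup>+x. \<integral>\<^sup>+y. liminf (\<lambda>n. ennreal (W (Y n x - Y n y))) \<partial>\<Omega> \<partial>\<Omega>)"
    unfolding Z(2)[symmetric] by (subst cross_eq) (auto intro!: nn_integral_cong simp: lim_W)
  also have "\<dots> \<le> (\<integral>\<^sup>+x. liminf (\<lambda>n. \<integral>\<^sup>+y. ennreal (W (Y n x - Y n y)) \<partial>\<Omega>) \<partial>\<Omega>)"
    by (intro nn_integral_mono nn_integral_liminf) measurable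
  also have "\<dots> \<le> liminf (\<lambda>n. \<integral>\<^sup>+x. \<integral>\<^sup>+y. ennreal (W (Y n x - Y n y)) \<partial>\<Omega> \<partial>\<Omega>)"
    by (intro nn_integral_liminf) measurable
  also have "(\<lambda>n. \<integral>\<^sup>+x. \<integral>\<^sup>+y. ennreal (W (Y n x - Y n y)) \<partial>\<Omega> \<partial>\<Omega>) = (\<lambda>n. cross (\<mu> n) (\<mu> n))"
    by (simp add: cross_eq flip: Y(2))
  finally show ?thesis .
qed

lemma cross_minimizer_exists:
  obtains M where "prob_R M" "cross M M < \<infinity>" "\<And>\<nu>. prob_R \<nu> \<Longrightarrow> cross M M \<le> cross \<nu> \<nu>"
proof -
  define I where "I = (INF \<nu>\<in>Collect prob_R. cross \<nu> \<nu>)"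
  have I_le: "I \<le> cross \<nu> \<nu>" if "prob_R \<nu>" for \<nu>
    unfolding I_def using that by (intro INF_lower) auto
  have "I < \<infinity>"
    using I_le[OF prob_R_return[of 0]] cross_finite[OF prob_R_return[of 0], of 0]
    by (auto simp: AE_return intro: le_less_trans)
  have "\<exists>\<nu>. prob_R \<nu> \<and> cross \<nu> \<nu> < I + ennreal (1 / Suc n)" for n
  proof -
    have "I < I + ennreal (1 / Suc n)"
      using \<open>I < \<infinity>\<close> by (cases I) (auto simp: ennreal_less_iff simp flip: ennreal_plus)
    then show ?thesis unfolding I_def by (subst (asm) (1) INF_less_iff) auto
  qed
  then obtain \<nu> where \<nu>: "\<And>n. prob_R (\<nu> n)" "\<And>n. cross (\<nu> n) (\<nu> n) < I + ennreal (1 / Suc n)"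
    by metis
  have le1: "I + ennreal (1 / Suc n) \<le> I + 1" for n
    by (intro add_left_mono) (simp add: ennreal_le_1)
  \<comment> \<open>Translation invariance lets mass escape to infinity. Some point has W-potential
    at most I + 1, as otherwise the average \<open>cross (\<nu> n) (\<nu> n)\<close> would reach
    that value; moving this point to the origin bounds the first moments uniformly.\<close>
  have "\<exists>x. (\<integral>\<^sup>+y. ennreal (W (x - y)) \<partial>\<nu> n) \<le> I + 1" for n
  proof (rule ccontr)
    assume "\<not> ?thesis"
    then have gt: "I + 1 \<le> (\<integral>\<^sup>+y. ennreal (W (x - y)) \<partial>\<nu> n)" for x
      by (meson not_le less_imp_le)
    interpret prob_space "\<nu> n" by (rule prob_R_space) (rule \<nu>)
    have "I + 1 = (\<integral>\<^sup>+x. I + 1 \<partial>\<nu> n)" by (simp add: emeasure_space_1)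
    also have "\<dots> \<le> cross (\<nu> n) (\<nu> n)" unfolding cross_def using gt by (intro nn_integral_mono)
    finally show False using less_le_trans[OF \<nu>(2)[of n] le1[of n]] by simp
  qed
  then obtain x where x: "\<And>n. (\<integral>\<^sup>+y. ennreal (W (x n - y)) \<partial>\<nu> n) \<le> I + 1" by metis
  define \<mu> where "\<mu> n = distr (\<nu> n) borel (\<lambda>y. y - x n)" for n
  have \<mu>: "prob_R (\<mu> n)" for n unfolding \<mu>_def by (rule prob_R_distr[OF \<nu>(1)]) measurable
  have cross_\<mu>: "cross (\<mu> n) (\<mu> n) = cross (\<nu> n) (\<nu> n)" for n
  proof -
    note [measurable_cong] = prob_R_sets[OF \<nu>(1)[of n]]
    show ?thesis
      unfolding \<mu>_def
      by (subst cross_distr) (auto simp: prob_R_sets prob_R_space \<nu>(1) cross_def)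
  qed
  obtain U where U: "U > 0" "\<And>u. \<bar>u\<bar> \<le> W u + U" using W_coercive by metis
  define B where "B = enn2real I + 1 + U"
  have B: "ennreal B = I + 1 + ennreal U" "0 \<le> B"
    using \<open>I < \<infinity>\<close> U by (auto simp: B_def ennreal_plus less_top)
  have "(\<integral>\<^sup>+y. ennreal \<bar>y\<bar> \<partial>\<mu> n) \<le> ennreal B" for n
  proof -
    note [measurable_cong] = prob_R_sets[OF \<nu>(1)[of n]]
    interpret prob_space "\<nu> n" by (rule prob_R_space) (rule \<nu>)
    have "(\<integral>\<^sup>+y. ennreal \<bar>y\<bar> \<partial>\<mu> n) = (\<integral>\<^sup>+y. ennreal \<bar>y - x n\<bar> \<partial>\<nu> n)"
      unfolding \<mu>_def by (subst nn_integral_distr) auto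
    also have "\<dots> \<le> (\<integral>\<^sup>+y. ennreal (W (x n - y)) + ennreal U \<partial>\<nu> n)"
    proof (rule nn_integral_mono)
      fix y
      have "\<bar>y - x n\<bar> \<le> W (x n - y) + U" using U(2)[of "x n - y"] by simp
      then show "ennreal \<bar>y - x n\<bar> \<le> ennreal (W (x n - y)) + ennreal U"
        using U W_nonneg by (simp flip: ennreal_plus)
    qed
    also have "\<dots> = (\<integral>\<^sup>+y. ennreal (W (x n - y)) \<partial>\<nu> n) + ennreal U"
      by (subst nn_integral_add) (auto simp: emeasure_space_1)
    also have "\<dots> \<le> ennreal B" unfolding B(1) using x by (intro add_right_mono)
    finally show ?thesis .
  qed
  then have "tight \<mu>" by (rule tight_of_bounded_first_moment[OF \<mu> _ B(2)])
  then obtain r M where r: "strict_mono r" and M: "real_distribution M"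
    and lim: "weak_conv_m (\<mu> \<circ> id \<circ> r) M"
    using tight_imp_convergent_subsubsequence[of \<mu> id] strict_mono_id by blast
  have "cross M M \<le> liminf (\<lambda>n. cross (\<mu> (r n)) (\<mu> (r n)))"
    using cross_weak_limit[OF _ M lim] \<mu> by simp
  also have "\<dots> \<le> liminf (\<lambda>n. I + ennreal (1 / Suc n))"
  proof (rule Liminf_mono, rule always_eventually, rule allI)
    fix n
    have "ennreal (1 / Suc (r n)) \<le> ennreal (1 / Suc n)"
      using seq_suble[OF r, of n] by (intro ennreal_leI frac_le) auto
    then have "I + ennreal (1 / Suc (r n)) \<le> I + ennreal (1 / Suc n)" by (rule add_left_mono)
    then show "cross (\<mu> (r n)) (\<mu> (r n)) \<le> I + ennreal (1 / Suc n)"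
      using order.strict_trans2[OF \<nu>(2)[of "r n"]] unfolding cross_\<mu> by (blast intro: less_imp_le)
  qed
  also have "\<dots> = I"
  proof (rule lim_imp_Liminf)
    have "(\<lambda>n. ennreal (1 / Suc n)) \<longlonglongrightarrow> ennreal 0"
      using LIMSEQ_inverse_real_of_nat by (intro tendsto_ennrealI) (simp add: inverse_eq_divide)
    then have "(\<lambda>n. I + ennreal (1 / Suc n)) \<longlonglongrightarrow> I + ennreal 0"
      by (intro tendsto_add tendsto_const)
    then show "(\<lambda>n. I + ennreal (1 / Suc n)) \<longlonglongrightarrow> I" by simp
  qed simp
  finally have le: "cross M M \<le> I" .
  show thesis
  proof (rule that)
    show "prob_R M" using M by (auto simp: prob_R_def real_distribution_def real_distribution_axioms_def)
    show "cross M M < \<infinity>" using le \<open>I < \<infinity>\<close> by simp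
    show "cross M M \<le> cross \<nu> \<nu>" if "prob_R \<nu>" for \<nu> using le I_le[OF that] by simp
  qed
qed

lemma global_min_directional_min:
  assumes "prob_R \<mu>" "\<And>\<nu>. prob_R \<nu> \<Longrightarrow> cross \<mu> \<mu> \<le> cross \<nu> \<nu>"
  shows "directional_min \<mu>"
  unfolding directional_min_def
proof (intro conjI allI impI)
  show "cross \<mu> \<mu> < \<infinity>"
    using assms(2)[OF prob_R_return[of 0]] cross_finite[OF prob_R_return[of 0], of 0]
    by (auto simp: AE_return intro: le_less_trans)
  fix \<nu> K assume "prob_R \<nu> \<and> (AE x in \<nu>. \<bar>x\<bar> \<le> K)"
  then show "\<exists>t0>0. t0 \<le> 1 \<and> (\<forall>t. 0 < t \<and> t < t0 \<longrightarrow> cross \<mu> \<mu> \<le> cross (mix t \<mu> \<nu>) (mix t \<mu> \<nu>))"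
    using assms prob_R_mix by (intro exI[of _ 1]) auto
qed (use assms in auto)

lemma cross_rho_star_shift: "cross (rho_star c) (rho_star c) = cross (rho_star d) (rho_star d)"
proof -
  have [simp]: "cross (return borel x) (return borel y) = ennreal (W (x - y))" for x y
    by (simp add: cross_return prob_R_return W_commute nn_integral_return)
  have "W (c - (c + 1)) = W 1" for c using W_commute[of 0 1] by simp
  then have "cross (rho_star c) (rho_star c) = ennreal ((1 - 1 / 2)\<^sup>2) * ennreal (W 0)
      + ennreal (2 * (1 / 2) * (1 - 1 / 2)) * ennreal (W 1) + ennreal ((1 / 2)\<^sup>2) * ennreal (W 0)" for c
    unfolding rho_star_eq_mix by (subst cross_mix) (simp_all add: prob_R_return)
  then show ?thesis by simp
qed

text \<open>The positive part may be infinite, the negative part integrates to at most 1/q.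
  Integrating W + V^- = V^+ + 1/q avoids subtraction in \<open>ennreal\<close>; the finite terms are
  moved across only afterwards, in \<open>ereal\<close>.\<close>

lemma energy_eq_cross:
  assumes \<rho>: "prob_R \<rho>"
  shows "energy p q \<rho> = ereal (1 / 2) * (enn2ereal (cross \<rho> \<rho>) - ereal (1 / q))"
proof -
  interpret prob_space \<rho> by (rule prob_R_space) fact
  interpret P: pair_prob_space \<rho> \<rho> ..
  note [measurable_cong] = prob_R_sets[OF \<rho>]
  define Pos Neg where "Pos = (\<integral>\<^sup>+z. ennreal (max 0 (V (fst z - snd z))) \<partial>(\<rho> \<Otimes>\<^sub>M \<rho>))"
    and "Neg = (\<integral>\<^sup>+z. ennreal (max 0 (- V (fst z - snd z))) \<partial>(\<rho> \<Otimes>\<^sub>M \<rho>))"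
  have q0: "q > 0" using q_ge_2 by simp
  have "Neg \<le> (\<integral>\<^sup>+z. ennreal (1 / q) \<partial>(\<rho> \<Otimes>\<^sub>M \<rho>))"
    unfolding Neg_def using q0 by (intro nn_integral_mono ennreal_leI) (auto simp: neg_V_le)
  also have "\<dots> = ennreal (1 / q)" by (simp add: P.emeasure_space_1)
  finally obtain N where N: "Neg = ennreal N" "0 \<le> N"
    by (cases Neg) (auto simp: top_unique)
  have "cross \<rho> \<rho> = (\<integral>\<^sup>+z. ennreal (W (fst z - snd z)) \<partial>(\<rho> \<Otimes>\<^sub>M \<rho>))"
    unfolding cross_def by (subst nn_integral_fst[symmetric]) auto
  then have "cross \<rho> \<rho> + Neg
      = (\<integral>\<^sup>+z. ennreal (W (fst z - snd z)) + ennreal (max 0 (- V (fst z - snd z))) \<partial>(\<rho> \<Otimes>\<^sub>M \<rho>))"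
    unfolding Neg_def by (subst nn_integral_add) auto
  also have "\<dots> = (\<integral>\<^sup>+z. ennreal (max 0 (V (fst z - snd z))) + ennreal (1 / q) \<partial>(\<rho> \<Otimes>\<^sub>M \<rho>))"
    using q0 W_nonneg by (intro nn_integral_cong) (auto simp: W_def max_def simp flip: ennreal_plus)
  also have "\<dots> = Pos + ennreal (1 / q)"
    unfolding Pos_def by (subst nn_integral_add) (auto simp: P.emeasure_space_1)
  finally have eq: "cross \<rho> \<rho> + ennreal N = Pos + ennreal (1 / q)" by (simp add: N)
  have "enn2ereal Pos - ereal N = enn2ereal (cross \<rho> \<rho>) - ereal (1 / q)"
  proof (cases Pos)
    case (real P)
    then have "cross \<rho> \<rho> + ennreal N = ennreal (P + 1 / q)" using eq q0 by simp
    then obtain c where c: "cross \<rho> \<rho> = ennreal c" "0 \<le> c" 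
      by (cases "cross \<rho> \<rho>") auto
    have "c + N = P + 1 / q"
      using eq real c N q0 by (simp add: ennreal_inj flip: ennreal_plus)
    then show ?thesis using real c N by (simp add: enn2ereal_ennreal)
  next
    case top
    then have "cross \<rho> \<rho> = \<top>" using eq by (cases "cross \<rho> \<rho>") (auto simp flip: ennreal_plus)
    then show ?thesis using top by simp
  qed
  then show ?thesis
    unfolding energy_def Pos_def[symmetric] Neg_def[symmetric] by (simp add: N enn2ereal_ennreal)
qed

lemma energy_le_iff:
  assumes "prob_R \<mu>" "prob_R \<nu>"
  shows "energy p q \<mu> \<le> energy p q \<nu> \<longleftrightarrow> cross \<mu> \<mu> \<le> cross \<nu> \<nu>"
  unfolding energy_eq_cross[OF assms(1)] energy_eq_cross[OF assms(2)]
  by (cases "cross \<mu> \<mu>"; cases "cross \<nu> \<nu>")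
    (auto simp: enn2ereal_ennreal ennreal_le_iff divide_right_mono top_unique)

end

section \<open>Local minimizers\<close>

lemma wasserstein_le:
  assumes "\<pi> \<in> couplings \<mu> \<nu>" "(\<integral>\<^sup>+z. ennreal (\<bar>fst z - snd z\<bar> powr lam) \<partial>\<pi>) \<le> ennreal (\<eta> powr lam)"
    and "0 \<le> \<eta>" "1 \<le> lam"
  shows "wasserstein lam \<mu> \<nu> \<le> \<eta>"
proof -
  have "(INF \<pi>\<in>couplings \<mu> \<nu>. \<integral>\<^sup>+z. ennreal (\<bar>fst z - snd z\<bar> powr lam) \<partial>\<pi>) \<le> ennreal (\<eta> powr lam)"
    using assms by (intro INF_lower2)
  then have "enn2real (INF \<pi>\<in>couplings \<mu> \<nu>. \<integral>\<^sup>+z. ennreal (\<bar>fst z - snd z\<bar> powr lam) \<partial>\<pi>) \<le> \<eta> powr lam"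
    using enn2real_leI by (metis powr_ge_zero)
  then have "wasserstein lam \<mu> \<nu> \<le> (\<eta> powr lam) powr (1 / lam)"
    unfolding wasserstein_def using assms by (intro powr_mono2) auto
  then show ?thesis using assms by (simp add: powr_powr)
qed

text \<open>The transport plan of the map f, carried by its graph.\<close>

lemma coupling_distr:
  assumes \<mu>: "prob_R \<mu>" and [measurable]: "f \<in> borel \<rightarrow>\<^sub>M borel"
  shows "distr \<mu> (borel \<Otimes>\<^sub>M borel) (\<lambda>x. (x, f x)) \<in> couplings \<mu> (distr \<mu> borel f)"
proof -
  note [measurable_cong] = prob_R_sets[OF \<mu>]
  interpret prob_space \<mu> by (rule prob_R_space) fact
  have "distr \<mu> borel (\<lambda>x. x) = \<mu>" by (rule distr_id2) (simp add: prob_R_sets[OF \<mu>])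
  then show ?thesis
    by (auto simp: couplings_def distr_distr comp_def intro!: prob_space_distr)
qed

text \<open>The mass 1 - t stays where it is, on the diagonal, and only the share t is transported,
  by the product coupling. The cost is therefore proportional to t.\<close>

lemma coupling_mix:
  assumes \<mu>: "prob_R \<mu>" and \<nu>: "prob_R \<nu>" and t: "0 \<le> t" "t \<le> 1"
  defines "D \<equiv> distr \<mu> (borel \<Otimes>\<^sub>M borel) (\<lambda>x. (x, x))"
  shows "mix t D (\<mu> \<Otimes>\<^sub>M \<nu>) \<in> couplings \<mu> (mix t \<mu> \<nu>)"
proof -
  note [measurable_cong] = prob_R_sets[OF \<mu>] prob_R_sets[OF \<nu>]
  interpret \<mu>: prob_space \<mu> by (rule prob_R_space) fact
  interpret \<nu>: prob_space \<nu> by (rule prob_R_space) fact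
  interpret P: pair_prob_space \<mu> \<nu> ..
  have D: "prob_space D" unfolding D_def by (rule \<mu>.prob_space_distr) measurable
  have sets_P: "sets (\<mu> \<Otimes>\<^sub>M \<nu>) = sets (borel \<Otimes>\<^sub>M borel)"
    by (rule sets_pair_measure_cong) (auto simp: prob_R_sets \<mu> \<nu>)
  have sets_D: "sets D = sets (borel \<Otimes>\<^sub>M borel)" by (simp add: D_def)
  have PP: "prob_space (\<mu> \<Otimes>\<^sub>M \<nu>)" by (rule P.prob_space_axioms)
  have sets_mixP: "sets (mix t D (\<mu> \<Otimes>\<^sub>M \<nu>)) = sets (borel \<Otimes>\<^sub>M borel)"
    using D PP sets_P sets_D by simp
  have space_mixP: "space (mix t D (\<mu> \<Otimes>\<^sub>M \<nu>)) = UNIV"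
    using sets_eq_imp_space_eq[OF sets_mixP] by (simp add: space_pair_measure)
  have em: "emeasure (mix t D (\<mu> \<Otimes>\<^sub>M \<nu>)) A
      = ennreal (1 - t) * emeasure D A + ennreal t * emeasure (\<mu> \<Otimes>\<^sub>M \<nu>) A"
    if "A \<in> sets (borel \<Otimes>\<^sub>M borel)" for A
    using that D PP sets_P sets_D t by (intro emeasure_mix) auto
  have [measurable]: "f \<in> mix t D (\<mu> \<Otimes>\<^sub>M \<nu>) \<rightarrow>\<^sub>M borel" if "f \<in> borel \<Otimes>\<^sub>M borel \<rightarrow>\<^sub>M borel"
    for f :: "real \<times> real \<Rightarrow> real"
    using that measurable_cong_sets[OF sets_mixP refl] by blast
  have em_D: "emeasure D (A \<times> UNIV) = emeasure \<mu> A" "emeasure D (UNIV \<times> A) = emeasure \<mu> A"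
    if [measurable]: "A \<in> sets borel" for A
    unfolding D_def by (auto simp: vimage_def emeasure_distr prob_R_sets[OF \<mu>] sets_eq_imp_space_eq[OF prob_R_sets[OF \<mu>]])
  have UNIVs: "emeasure \<mu> UNIV = 1" "emeasure \<nu> UNIV = 1"
    using \<mu>.emeasure_space_1 \<nu>.emeasure_space_1 sets_eq_imp_space_eq[OF prob_R_sets[OF \<mu>]]
      sets_eq_imp_space_eq[OF prob_R_sets[OF \<nu>]] by auto
  have em_P: "emeasure (\<mu> \<Otimes>\<^sub>M \<nu>) (A \<times> B) = emeasure \<mu> A * emeasure \<nu> B"
    if "A \<in> sets borel" "B \<in> sets borel" for A B
    using that by (intro \<nu>.emeasure_pair_measure_Times) (auto simp: prob_R_sets \<mu> \<nu>)
  have "distr (mix t D (\<mu> \<Otimes>\<^sub>M \<nu>)) borel fst = \<mu>"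
  proof (rule measure_eqI)
    fix A assume "A \<in> sets (distr (mix t D (\<mu> \<Otimes>\<^sub>M \<nu>)) borel fst)"
    then have A: "A \<in> sets borel" by simp
    have "fst -` A \<inter> space (mix t D (\<mu> \<Otimes>\<^sub>M \<nu>)) = A \<times> UNIV" by (auto simp: space_mixP)
    then have "emeasure (distr (mix t D (\<mu> \<Otimes>\<^sub>M \<nu>)) borel fst) A
        = emeasure (mix t D (\<mu> \<Otimes>\<^sub>M \<nu>)) (A \<times> UNIV)"
      using A by (subst emeasure_distr) auto
    also have "\<dots> = ennreal (1 - t) * emeasure \<mu> A + ennreal t * emeasure \<mu> A"
      using A by (subst em) (auto simp: em_D em_P UNIVs)
    also have "\<dots> = (ennreal (1 - t) + ennreal t) * emeasure \<mu> A" by (simp add: distrib_right)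
    also have "ennreal (1 - t) + ennreal t = 1" using t by (simp flip: ennreal_plus)
    finally show "emeasure (distr (mix t D (\<mu> \<Otimes>\<^sub>M \<nu>)) borel fst) A = emeasure \<mu> A" by simp
  qed (simp add: prob_R_sets \<mu>)
  moreover have "distr (mix t D (\<mu> \<Otimes>\<^sub>M \<nu>)) borel snd = mix t \<mu> \<nu>"
  proof (rule measure_eqI)
    have sets_m: "sets (mix t \<mu> \<nu>) = sets borel" using prob_R_sets[OF prob_R_mix[OF \<mu> \<nu> t]] .
    then show "sets (distr (mix t D (\<mu> \<Otimes>\<^sub>M \<nu>)) borel snd) = sets (mix t \<mu> \<nu>)" by simp
    fix A assume "A \<in> sets (distr (mix t D (\<mu> \<Otimes>\<^sub>M \<nu>)) borel snd)"
    then have A: "A \<in> sets borel" by simp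
    have "snd -` A \<inter> space (mix t D (\<mu> \<Otimes>\<^sub>M \<nu>)) = UNIV \<times> A" by (auto simp: space_mixP)
    then have "emeasure (distr (mix t D (\<mu> \<Otimes>\<^sub>M \<nu>)) borel snd) A
        = emeasure (mix t D (\<mu> \<Otimes>\<^sub>M \<nu>)) (UNIV \<times> A)"
      using A by (subst emeasure_distr) auto
    also have "\<dots> = ennreal (1 - t) * emeasure \<mu> A + ennreal t * emeasure \<nu> A"
      using A by (subst em) (auto simp: em_D em_P UNIVs)
    also have "\<dots> = emeasure (mix t \<mu> \<nu>) A"
      using A t by (intro emeasure_mix[symmetric])
        (auto simp: prob_R_sets \<mu> \<nu> \<mu>.prob_space_axioms \<nu>.prob_space_axioms)
    finally show "emeasure (distr (mix t D (\<mu> \<Otimes>\<^sub>M \<nu>)) borel snd) A = emeasure (mix t \<mu> \<nu>) A" .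
  qed
  moreover have "prob_space (mix t D (\<mu> \<Otimes>\<^sub>M \<nu>))"
    using D PP sets_P sets_D t by (intro prob_space_mix) auto
  ultimately show ?thesis using sets_mixP by (simp add: couplings_def)
qed

lemma prob_R_moment_bounded:
  assumes "prob_R \<nu>" "AE x in \<nu>. \<bar>x\<bar> \<le> K" "1 \<le> lam"
  shows "prob_R_moment lam \<nu>"
proof -
  interpret prob_space \<nu> by (rule prob_R_space) fact
  have "(\<integral>\<^sup>+x. ennreal (\<bar>x\<bar> powr lam) \<partial>\<nu>) \<le> (\<integral>\<^sup>+x. ennreal (K powr lam) \<partial>\<nu>)"
    using assms(2) by (intro nn_integral_mono_AE, eventually_elim)
      (use assms(3) in \<open>auto intro!: ennreal_leI powr_mono2\<close>)
  also have "\<dots> < \<infinity>" by (simp add: emeasure_space_1)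
  finally show ?thesis using assms(1) by (simp add: prob_R_moment_def)
qed

lemma prob_R_moment_mix:
  assumes "prob_R_moment lam \<mu>" "prob_R_moment lam \<nu>" "0 \<le> t" "t \<le> 1"
  shows "prob_R_moment lam (mix t \<mu> \<nu>)"
proof -
  have \<mu>: "prob_R \<mu>" and \<nu>: "prob_R \<nu>" using assms by (auto simp: prob_R_moment_def)
  note [measurable_cong] = prob_R_sets[OF \<mu>]
  have "(\<integral>\<^sup>+x. ennreal (\<bar>x\<bar> powr lam) \<partial>mix t \<mu> \<nu>)
     = ennreal (1 - t) * (\<integral>\<^sup>+x. ennreal (\<bar>x\<bar> powr lam) \<partial>\<mu>) + ennreal t * (\<integral>\<^sup>+x. ennreal (\<bar>x\<bar> powr lam) \<partial>\<nu>)"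
    using assms by (intro nn_integral_mix) (auto simp: prob_R_space prob_R_sets \<mu> \<nu>)
  also have "\<dots> < \<infinity>" using assms by (auto simp: prob_R_moment_def ennreal_mult_less_top)
  finally show ?thesis using prob_R_mix[OF \<mu> \<nu> assms(3,4)] by (simp add: prob_R_moment_def)
qed

lemma abs_diff_powr_le:
  fixes x y :: real
  assumes "0 \<le> lam"
  shows "\<bar>x - y\<bar> powr lam \<le> 2 powr lam * (\<bar>x\<bar> powr lam + \<bar>y\<bar> powr lam)"
proof -
  have "\<bar>x - y\<bar> powr lam \<le> (2 * max \<bar>x\<bar> \<bar>y\<bar>) powr lam"
    using assms by (intro powr_mono2) auto
  also have "\<dots> = 2 powr lam * max \<bar>x\<bar> \<bar>y\<bar> powr lam" by (simp add: powr_mult)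
  also have "\<dots> \<le> 2 powr lam * (\<bar>x\<bar> powr lam + \<bar>y\<bar> powr lam)"
    by (intro mult_left_mono) (auto simp: max_def)
  finally show ?thesis .
qed

lemma wasserstein_mix_le:
  assumes \<mu>: "prob_R_moment lam \<mu>" and \<nu>: "prob_R_moment lam \<nu>" and lam: "1 \<le> lam" and "0 < \<eta>"
  obtains t0 where "0 < t0" "t0 \<le> 1" "\<And>t. 0 < t \<Longrightarrow> t < t0 \<Longrightarrow> wasserstein lam \<mu> (mix t \<mu> \<nu>) \<le> \<eta>"
proof -
  have pr: "prob_R \<mu>" "prob_R \<nu>" using \<mu> \<nu> by (auto simp: prob_R_moment_def)
  note [measurable_cong] = prob_R_sets[OF pr(1)] prob_R_sets[OF pr(2)]
  interpret \<mu>: prob_space \<mu> by (rule prob_R_space) fact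
  interpret \<nu>: prob_space \<nu> by (rule prob_R_space) fact
  interpret P: pair_prob_space \<mu> \<nu> ..
  define c where "c z = ennreal (\<bar>fst z - snd z\<bar> powr lam)" for z :: "real \<times> real"
  have [measurable]: "c \<in> borel_measurable (borel \<Otimes>\<^sub>M borel)" unfolding c_def by measurable
  define D where "D = distr \<mu> (borel \<Otimes>\<^sub>M borel) (\<lambda>x. (x, x))"
  define m where "m \<mu> = (\<integral>\<^sup>+x. ennreal (\<bar>x\<bar> powr lam) \<partial>\<mu>)" for \<mu> :: "real measure"
  have m: "m \<mu> < \<infinity>" "m \<nu> < \<infinity>" using \<mu> \<nu> by (auto simp: prob_R_moment_def m_def)
  have "(\<integral>\<^sup>+z. c z \<partial>(\<mu> \<Otimes>\<^sub>M \<nu>)) = (\<integral>\<^sup>+x. \<integral>\<^sup>+y. c (x, y) \<partial>\<nu> \<partial>\<mu>)"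
    by (rule \<nu>.nn_integral_fst[symmetric]) measurable
  also have "\<dots> \<le> (\<integral>\<^sup>+x. \<integral>\<^sup>+y. ennreal (2 powr lam) * (ennreal (\<bar>x\<bar> powr lam) + ennreal (\<bar>y\<bar> powr lam)) \<partial>\<nu> \<partial>\<mu>)"
    using abs_diff_powr_le[of lam] lam unfolding c_def
    by (intro nn_integral_mono) (auto simp flip: ennreal_mult ennreal_plus intro!: ennreal_leI)
  also have "\<dots> = (\<integral>\<^sup>+x. ennreal (2 powr lam) * (ennreal (\<bar>x\<bar> powr lam) + m \<nu>) \<partial>\<mu>)"
    by (simp add: nn_integral_cmult nn_integral_add m_def \<nu>.emeasure_space_1)
  also have "\<dots> = ennreal (2 powr lam) * (m \<mu> + m \<nu>)"
    by (simp add: nn_integral_cmult nn_integral_add m_def \<mu>.emeasure_space_1)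
  also have "\<dots> < \<infinity>" using m by (auto simp: ennreal_mult_less_top)
  finally obtain k where k: "(\<integral>\<^sup>+z. c z \<partial>(\<mu> \<Otimes>\<^sub>M \<nu>)) = ennreal k" "0 \<le> k"
    by (cases "\<integral>\<^sup>+z. c z \<partial>(\<mu> \<Otimes>\<^sub>M \<nu>)") auto
  \<comment> \<open>The coupling of the mixture costs t k, with k the finite cost of the product
    coupling; k + 1 avoids division by 0.\<close>
  define t0 where "t0 = min 1 (\<eta> powr lam / (k + 1))"
  have t0: "0 < t0" "t0 \<le> 1" using \<open>0 < \<eta>\<close> k by (auto simp: t0_def)
  have "wasserstein lam \<mu> (mix t \<mu> \<nu>) \<le> \<eta>" if t: "0 < t" "t < t0" for t
  proof (rule wasserstein_le)
    have t1: "0 \<le> t" "t \<le> 1" using t t0 by auto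
    show "mix t D (\<mu> \<Otimes>\<^sub>M \<nu>) \<in> couplings \<mu> (mix t \<mu> \<nu>)"
      unfolding D_def by (rule coupling_mix[OF pr t1])
    have "prob_space D" unfolding D_def by (rule \<mu>.prob_space_distr) measurable
    moreover have "sets (\<mu> \<Otimes>\<^sub>M \<nu>) = sets D"
      unfolding D_def sets_distr by (rule sets_pair_measure_cong) (auto simp: prob_R_sets pr)
    moreover have "prob_space (\<mu> \<Otimes>\<^sub>M \<nu>)" by (rule P.prob_space_axioms)
    moreover have "c \<in> borel_measurable D" by (simp add: D_def)
    ultimately have "(\<integral>\<^sup>+z. c z \<partial>mix t D (\<mu> \<Otimes>\<^sub>M \<nu>))
        = ennreal (1 - t) * (\<integral>\<^sup>+z. c z \<partial>D) + ennreal t * (\<integral>\<^sup>+z. c z \<partial>(\<mu> \<Otimes>\<^sub>M \<nu>))"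
      using t1 by (intro nn_integral_mix) auto
    also have "(\<integral>\<^sup>+z. c z \<partial>D) = 0" unfolding D_def by (subst nn_integral_distr) (auto simp: c_def)
    also have "ennreal (1 - t) * 0 + ennreal t * (\<integral>\<^sup>+z. c z \<partial>(\<mu> \<Otimes>\<^sub>M \<nu>)) = ennreal (t * k)"
      using t1 k by (simp add: ennreal_mult)
    also have "\<dots> \<le> ennreal (\<eta> powr lam)"
    proof (rule ennreal_leI)
      have "t * k \<le> \<eta> powr lam / (k + 1) * (k + 1)"
        using t t1 k by (intro mult_mono) (auto simp: t0_def)
      then show "t * k \<le> \<eta> powr lam" using k by simp
    qed
    finally show "(\<integral>\<^sup>+z. ennreal (\<bar>fst z - snd z\<bar> powr lam) \<partial>mix t D (\<mu> \<Otimes>\<^sub>M \<nu>)) \<le> ennreal (\<eta> powr lam)"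
      unfolding c_def .
  qed (use \<open>0 < \<eta>\<close> lam in auto)
  then show thesis using t0 by (intro that) auto
qed

text \<open>Truncation to the interval from -n to n moves \<mu> arbitrarily little, by dominated
  convergence. This is how a local minimizer is seen to have finite energy: a moment of order lam
  need not control the p-term, but truncations close to it have finite energy.\<close>

lemma wasserstein_bounded_approx:
  assumes \<mu>: "prob_R_moment lam \<mu>" and lam: "1 \<le> lam" and "0 < \<eta>"
  obtains \<nu> K where "prob_R \<nu>" "AE x in \<nu>. \<bar>x\<bar> \<le> K" "wasserstein lam \<mu> \<nu> \<le> \<eta>"
proof -
  have pr: "prob_R \<mu>" using \<mu> by (auto simp: prob_R_moment_def)
  note [measurable_cong] = prob_R_sets[OF pr]
  define T where "T n x = max (- real n) (min (real n) x)" for n :: nat and x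
  have [measurable]: "T n \<in> borel \<rightarrow>\<^sub>M borel" for n unfolding T_def by measurable
  have "(\<lambda>n. \<integral>\<^sup>+x. ennreal (\<bar>x - T n x\<bar> powr lam) \<partial>\<mu>) \<longlonglongrightarrow> (\<integral>\<^sup>+x. 0 \<partial>\<mu>)"
  proof (rule nn_integral_dominated_convergence[where w = "\<lambda>x. ennreal (\<bar>x\<bar> powr lam)"])
    show "AE x in \<mu>. ennreal (\<bar>x - T n x\<bar> powr lam) \<le> ennreal (\<bar>x\<bar> powr lam)" for n
      using lam by (intro AE_I2 ennreal_leI powr_mono2) (auto simp: T_def)
    show "AE x in \<mu>. (\<lambda>n. ennreal (\<bar>x - T n x\<bar> powr lam)) \<longlonglongrightarrow> 0"
    proof (rule AE_I2)
      fix x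
      obtain N where N: "\<bar>x\<bar> \<le> real N" using real_arch_simple by blast
      have "\<forall>\<^sub>F n in sequentially. ennreal (\<bar>x - T n x\<bar> powr lam) = 0"
        using eventually_ge_at_top[of N]
      proof eventually_elim
        case (elim n)
        then have "\<bar>x\<bar> \<le> real n" using N by linarith
        then have "T n x = x" by (auto simp: T_def)
        then show ?case by simp
      qed
      then show "(\<lambda>n. ennreal (\<bar>x - T n x\<bar> powr lam)) \<longlonglongrightarrow> 0" by (rule tendsto_eventually)
    qed
  qed (use \<mu> in \<open>auto simp: prob_R_moment_def\<close>)
  then have "\<forall>\<^sub>F n in sequentially. (\<integral>\<^sup>+x. ennreal (\<bar>x - T n x\<bar> powr lam) \<partial>\<mu>) < ennreal (\<eta> powr lam)"
    using \<open>0 < \<eta>\<close> by (intro order_tendstoD) auto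
  then obtain n where n: "(\<integral>\<^sup>+x. ennreal (\<bar>x - T n x\<bar> powr lam) \<partial>\<mu>) < ennreal (\<eta> powr lam)"
    by (auto simp: eventually_sequentially)
  show thesis
  proof (rule that)
    show "prob_R (distr \<mu> borel (T n))" by (rule prob_R_distr[OF pr]) measurable
    show "AE x in distr \<mu> borel (T n). \<bar>x\<bar> \<le> real n"
      by (subst AE_distr_iff) (auto simp: T_def)
    show "wasserstein lam \<mu> (distr \<mu> borel (T n)) \<le> \<eta>"
    proof (rule wasserstein_le[OF coupling_distr[OF pr]])
      show "(\<integral>\<^sup>+z. ennreal (\<bar>fst z - snd z\<bar> powr lam) \<partial>distr \<mu> (borel \<Otimes>\<^sub>M borel) (\<lambda>x. (x, T n x)))
          \<le> ennreal (\<eta> powr lam)"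
        using n by (subst nn_integral_distr) auto
    qed (use \<open>0 < \<eta>\<close> lam in auto)
  qed
qed

lemma (in interaction_potential) local_minimizer_directional_min:
  assumes min: "local_minimizer p q lam \<mu>" and lam: "1 \<le> lam"
  shows "directional_min \<mu>"
proof -
  have \<mu>: "prob_R_moment lam \<mu>" "prob_R \<mu>"
    using min by (auto simp: local_minimizer_def prob_R_moment_def)
  obtain \<eta> where \<eta>: "\<eta> > 0"
    "\<And>\<nu>. prob_R_moment lam \<nu> \<Longrightarrow> wasserstein lam \<mu> \<nu> \<le> \<eta> \<Longrightarrow> energy p q \<mu> \<le> energy p q \<nu>"
    using min unfolding local_minimizer_def by blast
  have cross_le: "cross \<mu> \<mu> \<le> cross \<nu> \<nu>" if "prob_R_moment lam \<nu>" "wasserstein lam \<mu> \<nu> \<le> \<eta>" for \<nu>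
    using \<eta>(2)[OF that] energy_le_iff[OF \<mu>(2)] that(1) by (auto simp: prob_R_moment_def)
  obtain \<nu> K where \<nu>: "prob_R \<nu>" "AE x in \<nu>. \<bar>x\<bar> \<le> K" "wasserstein lam \<mu> \<nu> \<le> \<eta>"
    using wasserstein_bounded_approx[OF \<mu>(1) lam \<eta>(1)] .
  have fin: "cross \<mu> \<mu> < \<infinity>"
    using cross_le[OF prob_R_moment_bounded[OF \<nu>(1,2) lam] \<nu>(3)] cross_finite[OF \<nu>(1,2)]
    by (rule le_less_trans)
  show ?thesis
    unfolding directional_min_def
  proof (intro conjI allI impI)
    fix \<nu> K assume "prob_R \<nu> \<and> (AE x in \<nu>. \<bar>x\<bar> \<le> K)"
    then have \<nu>: "prob_R_moment lam \<nu>" using prob_R_moment_bounded lam by blast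
    obtain t0 where t0: "0 < t0" "t0 \<le> 1"
      "\<And>t. 0 < t \<Longrightarrow> t < t0 \<Longrightarrow> wasserstein lam \<mu> (mix t \<mu> \<nu>) \<le> \<eta>"
      using wasserstein_mix_le[OF \<mu>(1) \<nu> lam \<eta>(1)] by metis
    have "cross \<mu> \<mu> \<le> cross (mix t \<mu> \<nu>) (mix t \<mu> \<nu>)" if "0 < t" "t < t0" for t
      using that t0 by (intro cross_le prob_R_moment_mix \<mu> \<nu>) auto
    then show "\<exists>t0>0. t0 \<le> 1 \<and> (\<forall>t. 0 < t \<and> t < t0 \<longrightarrow> cross \<mu> \<mu> \<le> cross (mix t \<mu> \<nu>) (mix t \<mu> \<nu>))"
      using t0 by blast
  qed (use \<mu> fin in auto)
qed

section \<open>The characterisations of global and local minimizers\<close>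

context large_exponent
begin

text \<open>No direct comparison of energies is made: a minimizer exists, the classification makes
  it some translate, and all translates have equal energy.\<close>

lemma rho_star_global_min:
  assumes "prob_R \<nu>"
  shows "cross (rho_star c) (rho_star c) \<le> cross \<nu> \<nu>"
proof -
  obtain M where M: "prob_R M" "\<And>\<nu>. prob_R \<nu> \<Longrightarrow> cross M M \<le> cross \<nu> \<nu>"
    using cross_minimizer_exists by metis
  obtain d where "M = rho_star d"
    using directional_min_eq_rho_star[OF global_min_directional_min[OF M]] .
  then show ?thesis using M(2)[OF assms] cross_rho_star_shift[of c d] by simp
qed

lemma global_min_iff_rho_star:
  assumes "prob_R \<mu>"
  shows "(\<forall>\<nu>. prob_R \<nu> \<longrightarrow> energy p q \<mu> \<le> energy p q \<nu>) \<longleftrightarrow> (\<exists>c. \<mu> = rho_star c)"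
proof
  assume "\<forall>\<nu>. prob_R \<nu> \<longrightarrow> energy p q \<mu> \<le> energy p q \<nu>"
  then have "directional_min \<mu>"
    using assms energy_le_iff by (intro global_min_directional_min) auto
  then show "\<exists>c. \<mu> = rho_star c" by (rule directional_min_eq_rho_star) blast
next
  assume "\<exists>c. \<mu> = rho_star c"
  then show "\<forall>\<nu>. prob_R \<nu> \<longrightarrow> energy p q \<mu> \<le> energy p q \<nu>"
    using assms energy_le_iff rho_star_global_min by auto
qed

lemma local_minimizer_iff_rho_star:
  assumes lam: "1 \<le> lam"
  shows "local_minimizer p q lam \<mu> \<longleftrightarrow> (\<exists>c. \<mu> = rho_star c)"
proof
  assume "local_minimizer p q lam \<mu>"
  then have "directional_min \<mu>" using lam by (rule local_minimizer_directional_min)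
  then show "\<exists>c. \<mu> = rho_star c" by (rule directional_min_eq_rho_star) blast
next
  assume "\<exists>c. \<mu> = rho_star c"
  then obtain c where c: "\<mu> = rho_star c" by blast
  have "AE x in rho_star c. \<bar>x\<bar> \<le> \<bar>c\<bar> + 1"
  proof (rule AE_I')
    show "{x. \<not> \<bar>x\<bar> \<le> \<bar>c\<bar> + 1} \<in> null_sets (rho_star c)"
      by (auto simp: null_sets_def prob_R_sets[OF prob_R_rho_star] emeasure_rho_star indicator_def)
  qed auto
  then have "prob_R_moment lam \<mu>"
    unfolding c using lam by (intro prob_R_moment_bounded prob_R_rho_star)
  moreover have "energy p q \<mu> \<le> energy p q \<nu>" if "prob_R_moment lam \<nu>" for \<nu>
    using that global_min_iff_rho_star[of \<mu>] c prob_R_rho_star by (auto simp: prob_R_moment_def)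
  \<comment> \<open>Global minimality makes any radius admissible.\<close>
  ultimately show "local_minimizer p q lam \<mu>"
    by (auto simp: local_minimizer_def intro!: exI[of _ "1::real"])
qed

end

text \<open>The order of choices matters: \<delta> is fixed first, small in terms of q, and only
  then p tends to infinity, where (1 + \<delta>)^(p-q) outgrows p/q and (p - 1) (1 - \<delta>)^(p-q)
  tends to 0.\<close>

lemma eventually_large_exponent:
  assumes q: "2 \<le> q"
  obtains \<delta> where "\<forall>\<^sub>F p in at_top. large_exponent p q \<delta>"
proof -
  have "((\<lambda>\<delta>. (1 + \<delta>) powr q) \<longlongrightarrow> (1 + 0) powr q) (at_right 0)"
    by (intro tendsto_intros) auto
  then have 1: "\<forall>\<^sub>F \<delta> in at_right 0. (1 + \<delta>) powr q < 11 / 10"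
    by (rule order_tendstoD) simp
  have "((\<lambda>\<delta>. (1 - 5 * \<delta>) powr q) \<longlongrightarrow> (1 - 5 * 0) powr q) (at_right 0)"
    by (intro tendsto_intros) auto
  then have 2: "\<forall>\<^sub>F \<delta> in at_right 0. 9 / 10 < (1 - 5 * \<delta>) powr q"
    by (rule order_tendstoD) simp
  have 3: "\<forall>\<^sub>F \<delta> in at_right 0. \<delta> < 1 / 20 \<and> 0 < (\<delta>::real)"
    using eventually_at_right_real[of 0 "1 / 20 :: real"] by (auto elim: eventually_mono)
  have "\<forall>\<^sub>F \<delta> in at_right 0. (1 + \<delta>) powr q < 11 / 10 \<and> 9 / 10 < (1 - 5 * \<delta>) powr q \<and> \<delta> < 1 / 20 \<and> 0 < \<delta>"
    using 1 2 3 by eventually_elim auto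
  then obtain \<delta> where \<delta>: "(1 + \<delta>) powr q < 11 / 10" "9 / 10 < (1 - 5 * \<delta>) powr q" "\<delta> < 1 / 20" "0 < \<delta>"
    using eventually_happens'[OF trivial_limit_at_right_real] by blast
  have ln: "0 < ln (1 + \<delta>)" "ln (1 - \<delta>) < 0" using \<delta> by auto
  have lim1: "((\<lambda>p. (p / q) * exp (- (ln (1 + \<delta>)) * (p - q))) \<longlongrightarrow> 0) at_top"
    using ln q by real_asymp
  have lim2: "((\<lambda>p. (p - 1) * exp (ln (1 - \<delta>) * (p - q))) \<longlongrightarrow> 0) at_top"
    using ln q by real_asymp
  have "\<forall>\<^sub>F p in at_top. (p / q) * exp (- (ln (1 + \<delta>)) * (p - q)) < 1"
    using lim1 by (rule order_tendstoD) simp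
  moreover have "\<forall>\<^sub>F p in at_top. (p - 1) * exp (ln (1 - \<delta>) * (p - q)) < q - 1"
    using lim2 by (rule order_tendstoD) (use q in simp)
  moreover have "\<forall>\<^sub>F p in at_top. 110 * q \<le> p" by (rule eventually_ge_at_top)
  ultimately have "\<forall>\<^sub>F p in at_top. large_exponent p q \<delta>"
  proof eventually_elim
    case (elim p)
    have "(1 + \<delta>) powr (p - q) = exp (ln (1 + \<delta>) * (p - q))"
      "(1 - \<delta>) powr (p - q) = exp (ln (1 - \<delta>) * (p - q))"
      using \<delta> by (simp_all add: powr_def mult.commute)
    moreover have "p / q < exp (ln (1 + \<delta>) * (p - q))"
      using elim(1) q by (simp add: exp_minus inverse_eq_divide pos_divide_less_eq mult.commute)
    ultimately show ?case
      using elim \<delta> q by unfold_locales auto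
  qed
  then show thesis by (rule that)
qed

theorem theorem1:
  fixes q :: real
  assumes "q \<ge> 2"
  shows "\<exists>pstar::real. \<forall>p lam. p > q \<and> p > pstar \<and> 1 \<le> lam \<longrightarrow>
           (\<forall>\<rho>. local_minimizer p q lam \<rho> \<longleftrightarrow> (\<exists>c. \<rho> = rho_star c)) \<and>
           (\<forall>\<rho>. prob_R \<rho> \<longrightarrow>
              ((\<forall>\<rho>'. prob_R \<rho>' \<longrightarrow> energy p q \<rho> \<le> energy p q \<rho>') \<longleftrightarrow> (\<exists>c. \<rho> = rho_star c)))"
proof -
  obtain \<delta> where "\<forall>\<^sub>F p in at_top. large_exponent p q \<delta>"
    using eventually_large_exponent[OF assms] .
  \<comment> \<open>The threshold depends on q alone: lam enters none of the conditions of the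
    locale.\<close>
  then obtain pstar where "\<And>p. pstar \<le> p \<Longrightarrow> large_exponent p q \<delta>"
    by (auto simp: eventually_at_top_linorder)
  then have large: "large_exponent p q \<delta>" if "pstar < p" for p using that by simp
  show ?thesis
  proof (intro exI[of _ pstar] allI impI conjI)
    fix p lam :: real and \<rho> assume p: "p > q \<and> p > pstar \<and> 1 \<le> lam"
    then interpret large_exponent p q \<delta> using large by blast
    show "local_minimizer p q lam \<rho> \<longleftrightarrow> (\<exists>c. \<rho> = rho_star c)"
      using p by (intro local_minimizer_iff_rho_star) blast
    show "(\<forall>\<rho>'. prob_R \<rho>' \<longrightarrow> energy p q \<rho> \<le> energy p q \<rho>') \<longleftrightarrow> (\<exists>c. \<rho> = rho_star c)"
      if "prob_R \<rho>"
      using that by (rule global_min_iff_rho_star)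
  qed
qed

end
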